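(* Suppose Assumptions 1, 2 and 3 (stated in the context) hold. Consider the projected algorithm $$\dot{x}_i = P_{\Omega_i}\big(x_i-\nabla f_i(x_i)+\lambda_i\big)-x_i,$$ $$\dot{\lambda}_i = -\sum_{j\in\mathcal{N}_i}(\lambda_i-\lambda_j)-\sum_{j\in\mathcal{N}_i}(z_i-z_j)+(d_i-x_i),$$ $$\dot{z}_i = \sum_{j\in\mathcal{N}_i}(\lambda_i-\lambda_j),\qquad i\in\mathcal{N},$$ with (bounded) initial points satisfying $x_i(0)\in\Omega_i$ for all $i\in\mathcal{N}$. Then the trajectories of the algorithm are bounded and converge, as $t\to\infty$, to an equilibrium point of the algorithm; namely, for every $i\in\mathcal{N}$, $x_i(t)$ converges to $x_i^*$, where $(x_1^*,\dots,x_n^* )$ is the optimal solution of $$\min_{x_1,\dots,x_n\in\mathbf{R}^m}\ \sum_{i\in\mathcal{N}} f_i(x_i)\quad\text{subject to}\quad \sum_{i\in\mathcal{N}}x_i=\sum_{i\in\mathcal{N}}d_i,\quad x_i\in\Omega_i,\ i\in\mathcal{N}.$$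
   Context: Let $\mathcal{N}=\{1,\dots,n\}$ be a set of agents. For each $i\in\mathcal{N}$, $\Omega_i\subset\mathbf{R}^m$ is a closed convex set, $d_i\in\mathbf{R}^m$ is a given vector (local resource), and $f_i:\mathbf{R}^m\to\mathbf{R}$ is a local objective function. The resource allocation problem is to minimize $\sum_{i} f_i(x_i)$ over $x_1,\dots,x_n\in\mathbf{R}^m$ subject to $\sum_i x_i=\sum_i d_i$ and $x_i\in\Omega_i$ for all $i$. $P_{\Omega}(x)=\arg\min_{y\in\Omega}\|x-y\|$ denotes the Euclidean projection onto a closed convex set $\Omega$. $\mathcal{G}=(\mathcal{N},\mathcal{E})$ is the communication graph, and $\mathcal{N}_i=\{j : (j,i)\in\mathcal{E}\}$ is the neighbor set of agent $i$. The state variables are $x_i,\lambda_i,z_i\in\mathbf{R}^m$ for $i\in\mathcal{N}$; the initial values $\lambda_i(0),z_i(0)\in\mathbf{R}^m$ are arbitrary. A trajectory is a solution of the system of differential equations for $t\ge0$. An equilibrium point is a point at which the right-hand sides of all the differential equations vanish. Assumption 1: the functions $f_i$, $i\in\mathcal{N}$, are continuously differentiable convex functions with locally Lipschitz continuous gradients and with positive definite Hessians over $\mathbf{R}^m$. Assumption 2: there exists a finite optimal solution $X^*$ to the resource allocation problem, and Slater's condition holds: there exist $\tilde{x}_i\in \mathrm{int}(\Omega_i)$, $i\in\mathcal{N}$, with $\sum_{i}\tilde{x}_i=\sum_i d_i$. Assumption 3: the graph $\mathcal{G}$ is undirected and connected. *)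

theory Defs
  imports "HOL-Analysis.Analysis"
begin

text \<open>
  The agents are the elements of a finite type \<open>'n\<close>, and \<open>real ^ 'm\<close> is the space of
  local decisions; a joint vector such as \<open>(x\<^sub>1, \<dots>, x\<^sub>n)\<close> has type \<open>(real ^ 'm) ^ 'n\<close>.
\<close>

definition grad :: "('a::real_inner \<Rightarrow> real) \<Rightarrow> 'a \<Rightarrow> 'a" where
  "grad f x = (THE D. GDERIV f x :> D)"

lemma grad_eqI:
  assumes "GDERIV f x :> D"
  shows "grad f x = D"
  unfolding grad_def
proof (rule the_equality)
  show "GDERIV f x :> D" by (fact assms)
next
  fix D'
  assume "GDERIV f x :> D'"
  then have "(\<lambda>h. h \<bullet> D') = (\<lambda>h. h \<bullet> D)"
    using assms has_derivative_unique unfolding gderiv_def by blast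
  then have "\<forall>h. h \<bullet> D' = h \<bullet> D"
    by metis
  then show "D' = D"
    by (metis inner_commute inner_eq_zero_iff inner_diff_right eq_iff_diff_eq_0)
qed

lemma differentiable_imp_GDERIV_grad:
  fixes f :: "'a::euclidean_space \<Rightarrow> real"
  assumes "f differentiable (at x)"
  shows "GDERIV f x :> grad f x"
proof -
  obtain f' where f': "(f has_derivative f') (at x)"
    using assms by (auto simp: differentiable_def)
  have "f' = (\<lambda>h. h \<bullet> adjoint f' 1)"
    using adjoint_works[OF has_derivative_linear[OF f']] by auto
  with f' have "GDERIV f x :> adjoint f' 1"
    by (simp add: gderiv_def)
  then show ?thesis
    by (simp add: grad_eqI)
qed

definition hessian :: "(real ^ 'm \<Rightarrow> real) \<Rightarrow> real ^ 'm \<Rightarrow> real ^ 'm ^ 'm" where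
  "hessian f x = jacobian (grad f) (at x)"

(* Symmetry is not part of the definition: it is only applied to Hessians, which are symmetric
   wherever the gradient is differentiable. *)
definition positive_definite :: "real ^ 'm ^ 'm \<Rightarrow> bool" where
  "positive_definite A \<longleftrightarrow> (\<forall>v. v \<noteq> 0 \<longrightarrow> 0 < v \<bullet> (A *v v))"

definition locally_lipschitz :: "('a::metric_space \<Rightarrow> 'b::metric_space) \<Rightarrow> bool" where
  "locally_lipschitz g \<longleftrightarrow> (\<forall>x. \<exists>r>0. \<exists>L. L-lipschitz_on (ball x r) g)"

(* Differentiability of the gradient is the existence of the Hessian, so that the value of
   jacobian in the last conjunct is meaningful; continuity of the Hessian is not required. *)
definition regular_objective :: "(real ^ 'm \<Rightarrow> real) \<Rightarrow> bool" where
  "regular_objective f \<longleftrightarrow>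
     (\<forall>x. f differentiable (at x)) \<and> continuous_on UNIV (grad f) \<and>
     convex_on UNIV f \<and>
     locally_lipschitz (grad f) \<and>
     (\<forall>x. grad f differentiable (at x) \<and> positive_definite (hessian f x))"

definition feasible ::
  "('n::finite \<Rightarrow> (real ^ 'm) set) \<Rightarrow> ('n \<Rightarrow> real ^ 'm) \<Rightarrow> ((real ^ 'm) ^ 'n) set" where
  "feasible \<Omega> d = {x. (\<Sum>i\<in>UNIV. x $ i) = (\<Sum>i\<in>UNIV. d i) \<and> (\<forall>i. x $ i \<in> \<Omega> i)}"

definition optimal_allocation ::
  "('n::finite \<Rightarrow> (real ^ 'm) set) \<Rightarrow> ('n \<Rightarrow> real ^ 'm) \<Rightarrow> ('n \<Rightarrow> real ^ 'm \<Rightarrow> real) \<Rightarrow>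
    (real ^ 'm) ^ 'n \<Rightarrow> bool" where
  "optimal_allocation \<Omega> d f x \<longleftrightarrow>
     is_arg_min (\<lambda>y. \<Sum>i\<in>UNIV. f i (y $ i)) (\<lambda>y. y \<in> feasible \<Omega> d) x"

definition slater_condition ::
  "('n::finite \<Rightarrow> (real ^ 'm) set) \<Rightarrow> ('n \<Rightarrow> real ^ 'm) \<Rightarrow> bool" where
  "slater_condition \<Omega> d \<longleftrightarrow>
     (\<exists>x. (\<forall>i. x i \<in> interior (\<Omega> i)) \<and> (\<Sum>i\<in>UNIV. x i) = (\<Sum>i\<in>UNIV. d i))"

text \<open>The communication graph is given by its set of arcs, undirected meaning symmetric.\<close>

definition undirected_connected :: "('n \<times> 'n) set \<Rightarrow> bool" where
  "undirected_connected E \<longleftrightarrow> sym E \<and> (\<forall>i j. (i, j) \<in> E\<^sup>*)"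

definition neighbors :: "('n \<times> 'n) set \<Rightarrow> 'n \<Rightarrow> 'n set" where
  "neighbors E i = {j. (j, i) \<in> E}"

text \<open>
  The right-hand sides of the algorithm; \<open>closest_point (\<Omega> i)\<close> is the Euclidean
  projection onto \<open>\<Omega> i\<close>.
\<close>

definition x_rhs ::
  "('n::finite \<Rightarrow> (real ^ 'm) set) \<Rightarrow> ('n \<Rightarrow> real ^ 'm \<Rightarrow> real) \<Rightarrow>
    (real ^ 'm) ^ 'n \<Rightarrow> (real ^ 'm) ^ 'n \<Rightarrow> 'n \<Rightarrow> real ^ 'm" where
  "x_rhs \<Omega> f x lam i = closest_point (\<Omega> i) (x $ i - grad (f i) (x $ i) + lam $ i) - x $ i"

definition lambda_rhs ::
  "('n::finite \<times> 'n) set \<Rightarrow> ('n \<Rightarrow> real ^ 'm) \<Rightarrow>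
    (real ^ 'm) ^ 'n \<Rightarrow> (real ^ 'm) ^ 'n \<Rightarrow> (real ^ 'm) ^ 'n \<Rightarrow> 'n \<Rightarrow> real ^ 'm" where
  "lambda_rhs E d x lam z i =
     - (\<Sum>j\<in>neighbors E i. lam $ i - lam $ j) - (\<Sum>j\<in>neighbors E i. z $ i - z $ j) + (d i - x $ i)"

definition z_rhs :: "('n::finite \<times> 'n) set \<Rightarrow> (real ^ 'm) ^ 'n \<Rightarrow> 'n \<Rightarrow> real ^ 'm" where
  "z_rhs E lam i = (\<Sum>j\<in>neighbors E i. lam $ i - lam $ j)"

definition trajectory ::
  "('n::finite \<times> 'n) set \<Rightarrow> ('n \<Rightarrow> (real ^ 'm) set) \<Rightarrow> ('n \<Rightarrow> real ^ 'm) \<Rightarrow>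
    ('n \<Rightarrow> real ^ 'm \<Rightarrow> real) \<Rightarrow>
    (real \<Rightarrow> (real ^ 'm) ^ 'n) \<Rightarrow> (real \<Rightarrow> (real ^ 'm) ^ 'n) \<Rightarrow> (real \<Rightarrow> (real ^ 'm) ^ 'n) \<Rightarrow> bool" where
  "trajectory E \<Omega> d f x lam z \<longleftrightarrow>
     (\<forall>t\<ge>0. \<forall>i.
        ((\<lambda>s. x s $ i) has_vector_derivative x_rhs \<Omega> f (x t) (lam t) i) (at t within {0..}) \<and>
        ((\<lambda>s. lam s $ i) has_vector_derivative lambda_rhs E d (x t) (lam t) (z t) i) (at t within {0..}) \<and>
        ((\<lambda>s. z s $ i) has_vector_derivative z_rhs E (lam t) i) (at t within {0..}))"

definition equilibrium ::
  "('n::finite \<times> 'n) set \<Rightarrow> ('n \<Rightarrow> (real ^ 'm) set) \<Rightarrow> ('n \<Rightarrow> real ^ 'm) \<Rightarrow>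
    ('n \<Rightarrow> real ^ 'm \<Rightarrow> real) \<Rightarrow>
    (real ^ 'm) ^ 'n \<Rightarrow> (real ^ 'm) ^ 'n \<Rightarrow> (real ^ 'm) ^ 'n \<Rightarrow> bool" where
  "equilibrium E \<Omega> d f x lam z \<longleftrightarrow>
     (\<forall>i. x_rhs \<Omega> f x lam i = 0 \<and> lambda_rhs E d x lam z i = 0 \<and> z_rhs E lam i = 0)"

end

theory Submission
  imports Defs
begin

text \<open>
  Put \<open>s = (x, lam, z)\<close>. The algorithm is the projected dynamical system
  \<open>s' = P (s - F s) - s\<close>, where \<open>P\<close> projects onto the set of states that satisfy \<open>x\<^sub>i \<in> \<Omega>\<^sub>i\<close>
  and \<open>F\<close> is the saddle map of an augmented Lagrangian. This \<open>F\<close> is monotone: its skew couplings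
  cancel, and \<open>(F p - F q) \<bullet> (p - q)\<close> is the monotonicity gap of the gradients plus the Dirichlet
  form of the graph in \<open>lam\<close> (\<open>saddle_map_gap\<close>).

  For any rest point \<open>q\<close>, the regularized gap function of \<open>F\<close> plus half the squared
  distance to \<open>q\<close> decreases along trajectories at least at the rate \<open>(F s - F q) \<bullet> (s - q)\<close>
  (\<open>energy_derivative\<close>). So trajectories are bounded as soon as a rest point exists, and
  Barbalat's lemma shows that this rate tends to zero. It vanishes only where \<open>x\<close> is the optimum and
  the \<open>lam\<^sub>i\<close> agree. A second use of Barbalat's lemma, for the derivatives of these convergent
  quantities, together with the resource balance at the optimum, shows that the
  whole velocity tends to zero (\<open>trajectory_converges\<close>). Every limit point is therefore a rest point,
  and the energy relative to a limit point tends to zero, which gives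
  convergence (\<open>converges_if_velocity_vanishes\<close>).

  Rest points come from optimality (\<open>optimal_imp_equilibrium\<close>): under Slater's condition a
  separating hyperplane yields a common multiplier, and connectedness of the graph makes the Laplacian
  solvable for the local imbalances. Since the argument can be started from any optimal allocation
  \<open>X\<close> and always gives convergence of \<open>x\<close> to \<open>X\<close>, the optimal allocation is unique.
\<close>

section \<open>Barbalat arguments on the half line\<close>

text \<open>
  Barbalat's argument without integrals. Past a time where \<open>V\<close> is within \<open>\<delta> * \<epsilon>\<close> of its
  infimum, \<open>V\<close> drops by less than \<open>\<delta> * \<epsilon>\<close> over any window of length \<open>\<delta>\<close>; but uniform continuity
  keeps the dissipation on that window above \<open>W t - \<epsilon>\<close>, so \<open>W t\<close> cannot exceed \<open>2 * \<epsilon>\<close>.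
\<close>

lemma tendsto_zero_of_dissipation:
  fixes V V' W :: "real \<Rightarrow> real"
  assumes deriv: "\<And>t. 0 \<le> t \<Longrightarrow> (V has_real_derivative V' t) (at t within {0..})"
    and dissipation: "\<And>t. 0 \<le> t \<Longrightarrow> V' t \<le> - W t"
    and W_nonneg: "\<And>t. 0 \<le> t \<Longrightarrow> 0 \<le> W t"
    and V_nonneg: "\<And>t. 0 \<le> t \<Longrightarrow> 0 \<le> V t"
    and uc: "uniformly_continuous_on {0..} W"
  shows "(W \<longlongrightarrow> 0) at_top"
proof (rule tendstoI)
  fix e :: real assume "0 < e"
  define \<epsilon> where "\<epsilon> = e / 2"
  have "0 < \<epsilon>" using \<open>0 < e\<close> by (simp add: \<epsilon>_def)
  have mvt: "\<exists>\<xi>\<in>{a..b}. V b - V a = V' \<xi> * (b - a)" if "0 \<le> a" "a \<le> b" for a b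
  proof (rule mvt_very_simple[OF \<open>a \<le> b\<close>])
    fix t assume "a \<le> t" "t \<le> b"
    then show "(V has_derivative (\<lambda>h. V' t * h)) (at t within {a..b})"
      using deriv[of t] \<open>0 \<le> a\<close>
      by (auto simp: has_field_derivative_def intro: has_derivative_subset)
  qed
  obtain \<delta>' where "0 < \<delta>'"
    and \<delta>': "\<And>a b. \<lbrakk>0 \<le> a; 0 \<le> b; dist a b < \<delta>'\<rbrakk> \<Longrightarrow> dist (W a) (W b) < \<epsilon>"
    using uc \<open>0 < \<epsilon>\<close> unfolding uniformly_continuous_on_def by (metis atLeast_iff)
  define \<delta> where "\<delta> = \<delta>' / 2"
  have "0 < \<delta>" using \<open>0 < \<delta>'\<close> by (simp add: \<delta>_def)
  have \<delta>: "W a < W b + \<epsilon>" if "0 \<le> a" "a \<le> b" "b \<le> a + \<delta>" for a b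
    using \<delta>'[of a b] that \<open>0 < \<delta>'\<close> by (auto simp: \<delta>_def dist_real_def)
  define l where "l = (INF t\<in>{0..}. V t)"
  have bdd: "bdd_below (V ` {0..})"
    using V_nonneg by (intro bdd_belowI[of _ 0]) auto
  have l_le: "l \<le> V t" if "0 \<le> t" for t
    unfolding l_def using bdd that by (intro cINF_lower) auto
  have "l < l + \<delta> * \<epsilon>" using \<open>0 < \<delta>\<close> \<open>0 < \<epsilon>\<close> by simp
  then obtain T where "0 \<le> T" and T: "V T < l + \<delta> * \<epsilon>"
    using cINF_less_iff[OF _ bdd, of "l + \<delta> * \<epsilon>"] unfolding l_def by force
  show "\<forall>\<^sub>F t in at_top. dist (W t) 0 < e"
  proof (rule eventually_at_top_linorderI)
    fix t assume "T \<le> t"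
    then have "0 \<le> t" using \<open>0 \<le> T\<close> by simp
    have "V t \<le> V T"
    proof -
      obtain \<xi> where \<xi>: "\<xi> \<in> {T..t}" and eq: "V t - V T = V' \<xi> * (t - T)"
        using mvt[OF \<open>0 \<le> T\<close> \<open>T \<le> t\<close>] by blast
      then have "V' \<xi> \<le> 0"
        using dissipation[of \<xi>] W_nonneg[of \<xi>] \<open>0 \<le> T\<close> by auto
      then show ?thesis
        using eq \<open>T \<le> t\<close> mult_nonpos_nonneg[of "V' \<xi>" "t - T"] by linarith
    qed
    obtain \<xi> where \<xi>: "\<xi> \<in> {t..t + \<delta>}" and eq: "V (t + \<delta>) - V t = V' \<xi> * \<delta>"
      using mvt[of t "t + \<delta>"] \<open>0 \<le> t\<close> \<open>0 < \<delta>\<close> by auto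
    have "W t - \<epsilon> \<le> - V' \<xi>"
      using \<delta>[of t \<xi>] dissipation[of \<xi>] \<xi> \<open>0 \<le> t\<close> by auto
    then have "(W t - \<epsilon>) * \<delta> \<le> V t - V (t + \<delta>)"
      using eq \<open>0 < \<delta>\<close> mult_right_mono[of "W t - \<epsilon>" "- V' \<xi>" \<delta>] by simp
    also have "\<dots> < \<epsilon> * \<delta>"
      using T \<open>V t \<le> V T\<close> l_le[of "t + \<delta>"] \<open>0 \<le> t\<close> \<open>0 < \<delta>\<close> by (simp add: mult.commute)
    finally have "W t < e"
      using \<open>0 < \<delta>\<close> by (simp add: \<epsilon>_def)
    then show "dist (W t) 0 < e"
      using W_nonneg[OF \<open>0 \<le> t\<close>] by simp
  qed
qed

text \<open>
  Over a short window the increment of \<open>y\<close> is nearly \<open>\<delta>\<close> times \<open>y' t\<close>, by uniform continuity of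
  \<open>y'\<close>, while convergence of \<open>y\<close> makes that increment negligible compared with \<open>\<delta>\<close>.
\<close>

lemma derivative_tendsto_zero:
  fixes y y' :: "real \<Rightarrow> 'a::real_normed_vector"
  assumes deriv: "\<And>t. 0 \<le> t \<Longrightarrow> (y has_vector_derivative y' t) (at t within {0..})"
    and lim: "(y \<longlongrightarrow> l) at_top"
    and uc: "uniformly_continuous_on {0..} y'"
  shows "(y' \<longlongrightarrow> 0) at_top"
proof (rule tendstoI)
  fix e :: real assume "0 < e"
  define \<epsilon> where "\<epsilon> = e / 4"
  have "0 < \<epsilon>" using \<open>0 < e\<close> by (simp add: \<epsilon>_def)
  obtain \<delta>' where "0 < \<delta>'"
    and \<delta>': "\<And>a b. \<lbrakk>0 \<le> a; 0 \<le> b; dist a b < \<delta>'\<rbrakk> \<Longrightarrow> dist (y' a) (y' b) < \<epsilon>"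
    using uc \<open>0 < \<epsilon>\<close> unfolding uniformly_continuous_on_def by (metis atLeast_iff)
  define \<delta> where "\<delta> = \<delta>' / 2"
  have "0 < \<delta>" using \<open>0 < \<delta>'\<close> by (simp add: \<delta>_def)
  have \<delta>: "norm (y' b - y' a) \<le> \<epsilon>" if "0 \<le> a" "a \<le> b" "b \<le> a + \<delta>" for a b
    using \<delta>'[of b a] that \<open>0 < \<delta>'\<close> by (auto simp: \<delta>_def dist_norm)
  have "0 < \<delta> * \<epsilon>" using \<open>0 < \<delta>\<close> \<open>0 < \<epsilon>\<close> by simp
  then obtain T where T: "\<And>t. T \<le> t \<Longrightarrow> dist (y t) l < \<delta> * \<epsilon>"
    using tendstoD[OF lim] unfolding eventually_at_top_linorder by blast
  show "\<forall>\<^sub>F t in at_top. dist (y' t) 0 < e"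
  proof (rule eventually_at_top_linorderI)
    fix t assume t: "max 0 T \<le> t"
    have "norm (y (t + \<delta>) - y t - (t + \<delta> - t) *\<^sub>R y' t) \<le> norm (t + \<delta> - t) * \<epsilon>"
    proof (rule vector_differentiable_bound_linearization[where S = "{t..t + \<delta>}"])
      show "(y has_vector_derivative y' x) (at x within {t..t + \<delta>})" if "x \<in> {t..t + \<delta>}" for x
        using that t by (intro has_vector_derivative_within_subset[OF deriv]) auto
    qed (use \<delta> t \<open>0 < \<delta>\<close> in \<open>auto simp: closed_segment_eq_real_ivl\<close>)
    then have "norm (y (t + \<delta>) - y t - \<delta> *\<^sub>R y' t) \<le> \<delta> * \<epsilon>"
      using \<open>0 < \<delta>\<close> by simp
    moreover have "norm (y (t + \<delta>) - y t) < 2 * (\<delta> * \<epsilon>)"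
      using T[of t] T[of "t + \<delta>"] t \<open>0 < \<delta>\<close> dist_triangle2[of "y (t + \<delta>)" "y t" l]
      by (simp add: dist_norm)
    ultimately have "norm (\<delta> *\<^sub>R y' t) < 3 * (\<delta> * \<epsilon>)"
      using norm_triangle_ineq4[of "y (t + \<delta>) - y t" "y (t + \<delta>) - y t - \<delta> *\<^sub>R y' t"] by simp
    then have "\<delta> * norm (y' t) < \<delta> * (3 * \<epsilon>)"
      using \<open>0 < \<delta>\<close> by (simp add: mult.left_commute)
    then show "dist (y' t) 0 < e"
      using \<open>0 < \<delta>\<close> \<open>0 < e\<close> by (simp add: \<epsilon>_def)
  qed
qed

text \<open>
  On the compact part of the closure of the orbit where \<open>h\<close> is bounded away from zero, \<open>w\<close> attains
  a positive minimum; once \<open>w\<close> is below it, the trajectory has left that part. This turns pointwise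
  implications between zero sets into implications between limits along a bounded trajectory, and it
  replaces the invariance principle of LaSalle, which would need a flow on the limit set.
\<close>

lemma tendsto_zero_if_zeros_subset:
  fixes s :: "real \<Rightarrow> 'a::euclidean_space" and w :: "'a \<Rightarrow> 'b::real_normed_vector"
    and h :: "'a \<Rightarrow> 'c::real_normed_vector"
  assumes bdd: "bounded (s ` {0..})"
    and w: "continuous_on UNIV w" and h: "continuous_on UNIV h"
    and lim: "((\<lambda>t. w (s t)) \<longlongrightarrow> 0) at_top"
    and zeros: "\<And>p. w p = 0 \<Longrightarrow> h p = 0"
  shows "((\<lambda>t. h (s t)) \<longlongrightarrow> 0) at_top"
proof (rule tendstoI)
  fix e :: real assume "0 < e"
  define C where "C = closure (s ` {0..}) \<inter> {p. e \<le> norm (h p)}"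
  have "compact C"
    unfolding C_def using bdd h
    by (intro compact_Int_closed closed_Collect_le continuous_intros) (auto simp: compact_closure)
  have sC: "norm (h (s t)) < e" if "0 \<le> t" "s t \<notin> C" for t
  proof -
    have "s t \<in> closure (s ` {0..})" using that closure_subset[of "s ` {0..}"] by auto
    then show ?thesis using that by (auto simp: C_def)
  qed
  show "\<forall>\<^sub>F t in at_top. dist (h (s t)) 0 < e"
  proof (cases "C = {}")
    case True
    then show ?thesis using sC by (intro eventually_at_top_linorderI[of 0]) auto
  next
    case False
    have "continuous_on C (\<lambda>p. norm (w p))"
      using w by (intro continuous_intros) (auto intro: continuous_on_subset)
    then obtain q where "q \<in> C" and q: "\<And>p. p \<in> C \<Longrightarrow> norm (w q) \<le> norm (w p)"
      using continuous_attains_inf[OF \<open>compact C\<close> False] by blast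
    then have "0 < norm (w q)"
      using zeros[of q] \<open>0 < e\<close> by (auto simp: C_def)
    then have "\<forall>\<^sub>F t in at_top. dist (w (s t)) 0 < norm (w q)"
      using lim by (rule tendstoD[rotated])
    moreover have "\<forall>\<^sub>F t in at_top. (0::real) \<le> t" by (rule eventually_ge_at_top)
    ultimately show ?thesis
      by eventually_elim (use q sC in \<open>force\<close>)
  qed
qed

section \<open>Projections onto closed convex sets\<close>

text \<open>
  The squared distance is differentiable although the projection need not be. Comparing the distance of
  each of \<open>u\<close>, \<open>v\<close> with its distance to the projection of the other bounds the
  linearization error from both sides by a multiple of \<open>(norm (v - u))\<^sup>2\<close>; the lower bound uses that
  the projection is nonexpansive.
\<close>

lemma has_derivative_half_sq_dist_closest_point:
  fixes K :: "'a::euclidean_space set"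
  assumes K: "convex K" "closed K" "K \<noteq> {}"
  shows "((\<lambda>u. (norm (u - closest_point K u))\<^sup>2 / 2) has_derivative
    (\<lambda>h. (u - closest_point K u) \<bullet> h)) (at u)"
proof -
  let ?P = "closest_point K"
  let ?\<phi> = "\<lambda>u. (norm (u - ?P u))\<^sup>2 / 2"
  have le: "?\<phi> v \<le> (norm (v - ?P w))\<^sup>2 / 2" for v w
    using closest_point_le[of K "?P w" v] closest_point_in_set[of K w] K
    by (simp add: dist_norm)
  have err: "\<bar>?\<phi> v - ?\<phi> u - (u - ?P u) \<bullet> (v - u)\<bar> \<le> (norm (v - u))\<^sup>2" for v
  proof -
    have "(?P v - ?P u) \<bullet> (v - u) \<le> norm (?P v - ?P u) * norm (v - u)"
      by (rule norm_cauchy_schwarz)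
    also have "\<dots> \<le> norm (v - u) * norm (v - u)"
      using closest_point_lipschitz[OF K, of v u] by (intro mult_right_mono) (auto simp: dist_norm)
    finally have "(?P v - ?P u) \<bullet> (v - u) \<le> (v - u) \<bullet> (v - u)"
      by (simp add: dot_square_norm power2_eq_square)
    then show ?thesis
      using le[of v u] le[of u v] inner_ge_zero[of "v - u"]
      by (simp add: power2_norm_eq_inner inner_diff inner_commute field_simps abs_le_iff)
  qed
  have "((\<lambda>v. norm (?\<phi> v - ?\<phi> u - (u - ?P u) \<bullet> (v - u)) / norm (v - u)) \<longlongrightarrow> 0) (at u)"
  proof (rule tendsto_sandwich[where f = "\<lambda>_. 0" and h = "\<lambda>v. norm (v - u)"])
    show "\<forall>\<^sub>F v in at u. norm (?\<phi> v - ?\<phi> u - (u - ?P u) \<bullet> (v - u)) / norm (v - u) \<le> norm (v - u)"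
      using err by (intro always_eventually) (auto simp: divide_le_eq power2_eq_square)
    show "((\<lambda>v. norm (v - u)) \<longlongrightarrow> 0) (at u)"
      by (intro tendsto_eq_intros | simp)+
  qed auto
  then show ?thesis
    by (simp add: has_derivative_iff_norm bounded_linear_inner_right)
qed

section \<open>Projected dynamics of a monotone map\<close>

text \<open>
  Monotonicity of \<open>F\<close> says that \<open>F (p + r *\<^sub>R h) \<bullet> h\<close> is a nondecreasing function of \<open>r\<close>.
\<close>

lemma monotone_derivative_nonneg:
  fixes F :: "'a::real_inner \<Rightarrow> 'a"
  assumes mono: "\<And>p q. 0 \<le> (F p - F q) \<bullet> (p - q)" and D: "(F has_derivative D) (at p)"
  shows "0 \<le> D h \<bullet> h"
proof -
  let ?\<phi> = "\<lambda>r::real. F (p + r *\<^sub>R h) \<bullet> h"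
  have "((\<lambda>r. F (p + r *\<^sub>R h)) has_derivative (\<lambda>r. D (r *\<^sub>R h))) (at 0)"
    using D by (intro has_derivative_compose[where g = F and f = "\<lambda>r. p + r *\<^sub>R h"] derivative_eq_intros) auto
  then have "(?\<phi> has_derivative (\<lambda>r. D (r *\<^sub>R h) \<bullet> h)) (at 0)"
    by (rule has_derivative_inner_left)
  then have "(?\<phi> has_real_derivative D h \<bullet> h) (at 0)"
    using linear_cmul[OF has_derivative_linear[OF D]]
    by (simp add: has_field_derivative_def mult.commute[of _ "D h \<bullet> h"])
  moreover have "mono_on UNIV ?\<phi>"
  proof (rule mono_onI)
    fix r r' :: real assume "r \<le> r'"
    have "0 \<le> (F (p + r' *\<^sub>R h) - F (p + r *\<^sub>R h)) \<bullet> ((r' - r) *\<^sub>R h)"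
      using mono[of "p + r' *\<^sub>R h" "p + r *\<^sub>R h"] by (simp add: algebra_simps)
    then have "0 \<le> (r' - r) * (?\<phi> r' - ?\<phi> r)" by (simp add: inner_diff_left)
    with \<open>r \<le> r'\<close> show "?\<phi> r \<le> ?\<phi> r'"
      by (cases "r = r'") (auto simp: zero_le_mult_iff)
  qed
  ultimately show ?thesis
    using mono_on_imp_deriv_nonneg[of UNIV ?\<phi> "D h \<bullet> h" 0] by simp
qed

text \<open>
  The trajectory stays in \<open>K\<close> and is governed by the variational inequality of the monotone map \<open>F\<close>
  over \<open>K\<close>: the rest points are exactly the solutions of that inequality. Differentiability of
  \<open>F\<close> makes the energy below differentiable along the trajectory.
\<close>

locale monotone_projected_flow =
  fixes K :: "'a::euclidean_space set" and F :: "'a \<Rightarrow> 'a" and s :: "real \<Rightarrow> 'a"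
  assumes closed_K: "closed K" and convex_K: "convex K"
    and differentiable_F: "\<And>p. F differentiable (at p)"
    and monotone_F: "\<And>p q. 0 \<le> (F p - F q) \<bullet> (p - q)"
    and flow: "\<And>t. 0 \<le> t \<Longrightarrow>
      (s has_vector_derivative (closest_point K (s t - F (s t)) - s t)) (at t within {0..})"
    and init: "s 0 \<in> K"
begin

definition velocity :: "'a \<Rightarrow> 'a" where
  "velocity p = closest_point K (p - F p) - p"

lemma nonempty_K: "K \<noteq> {}"
  using init by auto

lemma flow_velocity: "0 \<le> t \<Longrightarrow> (s has_vector_derivative velocity (s t)) (at t within {0..})"
  using flow by (simp add: velocity_def)

lemma continuous_F: "continuous_on UNIV F"
  using differentiable_F differentiable_imp_continuous_within
  by (blast intro: continuous_at_imp_continuous_on)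

lemma continuous_velocity: "continuous_on UNIV velocity"
proof -
  have "continuous_on UNIV (closest_point K \<circ> (\<lambda>p. p - F p))"
    by (intro continuous_on_compose continuous_intros continuous_F
        continuous_on_closest_point convex_K closed_K nonempty_K)
  then show ?thesis
    unfolding velocity_def by (auto intro!: continuous_intros simp: o_def)
qed

text \<open>
  The obtuse-angle property of the projection of \<open>p - F p\<close>, whose value is \<open>p + velocity p\<close>. It
  yields both the variational inequality at rest points and the decrease of the energy.
\<close>

lemma residual_variational:
  assumes "q \<in> K"
  shows "0 \<le> (F p + velocity p) \<bullet> (q - p - velocity p)"
  using closest_point_dot[OF convex_K closed_K assms, of "p - F p"]
  by (simp add: velocity_def algebra_simps)

lemma rest_point_in_K: "velocity q = 0 \<Longrightarrow> q \<in> K"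
  using closest_point_in_set[OF closed_K nonempty_K, of "q - F q"] by (simp add: velocity_def)

lemma rest_point_variational: "\<lbrakk>velocity q = 0; y \<in> K\<rbrakk> \<Longrightarrow> 0 \<le> F q \<bullet> (y - q)"
  using residual_variational[of y q] by simp

text \<open>
  The velocity points from \<open>s t\<close> to a point of \<open>K\<close>, hence the squared distance to \<open>K\<close> is
  nonincreasing; it starts at zero.
\<close>

lemma trajectory_in_K:
  assumes "0 \<le> t"
  shows "s t \<in> K"
proof -
  let ?P = "closest_point K"
  let ?V = "\<lambda>t. (norm (s t - ?P (s t)))\<^sup>2 / 2"
  let ?D = "\<lambda>t. (s t - ?P (s t)) \<bullet> velocity (s t)"
  have "(?V has_derivative (\<lambda>h. h * ?D r)) (at r within {0..t})" if "0 \<le> r" "r \<le> t" for r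
  proof -
    have "(s has_derivative (\<lambda>h. h *\<^sub>R velocity (s r))) (at r within {0..t})"
      using flow_velocity[of r] that unfolding has_vector_derivative_def
      by (auto intro: has_derivative_subset)
    from has_derivative_compose[OF this
        has_derivative_half_sq_dist_closest_point[OF convex_K closed_K nonempty_K]]
    show ?thesis by simp
  qed
  then obtain r where r: "r \<in> {0..t}" and eq: "?V t - ?V 0 = (t - 0) * ?D r"
    using mvt_very_simple[OF assms, of ?V "\<lambda>r h. h * ?D r"] by blast
  let ?q = "?P (s r - F (s r))"
  have "?q \<in> K" using closed_K nonempty_K by (rule closest_point_in_set)
  then have "(s r - ?P (s r)) \<bullet> (?q - ?P (s r)) \<le> 0"
    by (rule closest_point_dot[OF convex_K closed_K])
  then have "?D r \<le> 0"
    using inner_ge_zero[of "s r - ?P (s r)"]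
    by (simp add: velocity_def inner_diff inner_commute)
  then have "?V t \<le> 0"
    using eq assms init mult_nonneg_nonpos[of t "?D r"] by (simp add: closest_point_self)
  then have "s t = ?P (s t)" by simp
  then show ?thesis
    using closest_point_in_set[OF closed_K nonempty_K] by metis
qed

text \<open>
  The first two terms form the regularized gap function of Fukushima,
  \<open>Max {F p \<bullet> (p - y) - (norm (p - y))\<^sup>2 / 2 | y. y \<in> K}\<close>, written through
  the distance of \<open>p - F p\<close> to \<open>K\<close> so that only the squared distance has to be differentiated.
  Half the squared distance to \<open>q\<close> is not enough as a Lyapunov function: the projection inequality bounds
  its derivative only up to \<open>- (F p + velocity p) \<bullet> velocity p\<close>, which is nonnegative on \<open>K\<close>, and the
  gap function compensates for this term.
\<close>

definition energy :: "'a \<Rightarrow> 'a \<Rightarrow> real" where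
  "energy q p = (F p \<bullet> F p) / 2 - (norm (p - F p - closest_point K (p - F p)))\<^sup>2 / 2
     + ((p - q) \<bullet> (p - q)) / 2"

text \<open>
  The gap part is nonnegative because \<open>p\<close> itself competes in the projection of \<open>p - F p\<close>.
\<close>

lemma energy_ge:
  assumes "p \<in> K"
  shows "(norm (p - q))\<^sup>2 / 2 \<le> energy q p"
proof -
  have "norm (p - F p - closest_point K (p - F p)) \<le> norm (F p)"
    using closest_point_le[OF closed_K assms, of "p - F p"] by (simp add: dist_norm)
  then have "(norm (p - F p - closest_point K (p - F p)))\<^sup>2 \<le> F p \<bullet> F p"
    by (simp add: power2_norm_eq_inner[symmetric])
  then show ?thesis by (simp add: energy_def power2_norm_eq_inner)
qed

lemma energy_rest_point: "velocity q = 0 \<Longrightarrow> energy q q = 0"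
  by (simp add: energy_def velocity_def power2_norm_eq_inner)

lemma continuous_energy: "continuous_on UNIV (energy q)"
proof -
  have "energy q = (\<lambda>p. (F p \<bullet> F p) / 2 - (norm (- F p - velocity p))\<^sup>2 / 2 + ((p - q) \<bullet> (p - q)) / 2)"
    by (auto simp: energy_def velocity_def fun_eq_iff algebra_simps)
  then show ?thesis
    by (auto intro!: continuous_intros continuous_F continuous_velocity)
qed

text \<open>
  Write \<open>h\<close> for the velocity and \<open>A\<close> for the derivative of \<open>F\<close> at \<open>s t\<close>. The derivative of the
  energy is \<open>F \<bullet> h + h \<bullet> h - h \<bullet> A h + (s t - q) \<bullet> h\<close>. The projection inequality tested with \<open>q\<close>
  bounds the sum without \<open>h \<bullet> A h\<close> by \<open>- F \<bullet> (s t - q)\<close>; the term \<open>h \<bullet> A h\<close> is nonnegative by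
  monotonicity; and the variational inequality at \<open>q\<close> lets \<open>F q\<close> be subtracted.
\<close>

lemma energy_derivative:
  assumes q: "velocity q = 0" and t: "0 \<le> t"
  shows "\<exists>D. ((\<lambda>t. energy q (s t)) has_real_derivative D) (at t within {0..}) \<and>
    D \<le> - ((F (s t) - F q) \<bullet> (s t - q))"
proof -
  obtain A where A: "(F has_derivative A) (at (s t))"
    using differentiable_F by (auto simp: differentiable_def)
  let ?h = "velocity (s t)" and ?F = "F (s t)"
  have s: "(s has_derivative (\<lambda>r. r *\<^sub>R ?h)) (at t within {0..})"
    using flow_velocity[OF t] by (simp add: has_vector_derivative_def)
  have Fs: "((\<lambda>t. F (s t)) has_derivative (\<lambda>r. r *\<^sub>R A ?h)) (at t within {0..})"
    using has_derivative_compose[OF s A] linear_cmul[OF has_derivative_linear[OF A]] by simp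
  have "((\<lambda>t. s t - F (s t)) has_derivative (\<lambda>r. r *\<^sub>R ?h - r *\<^sub>R A ?h)) (at t within {0..})"
    using s Fs by (rule has_derivative_diff)
  from has_derivative_compose[OF this
      has_derivative_half_sq_dist_closest_point[OF convex_K closed_K nonempty_K]]
  have dist: "((\<lambda>t. (norm (s t - F (s t) - closest_point K (s t - F (s t))))\<^sup>2 / 2) has_derivative
      (\<lambda>r. - (?F + ?h) \<bullet> (r *\<^sub>R ?h - r *\<^sub>R A ?h))) (at t within {0..})"
    by (simp add: velocity_def algebra_simps)
  note half = bounded_linear.has_derivative[OF bounded_linear_divide[of "2::real"]]
  have sq: "((\<lambda>t. s t - q) has_derivative (\<lambda>r. r *\<^sub>R ?h)) (at t within {0..})"
    using has_derivative_diff[OF s has_derivative_const[of q]] by simp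
  let ?D = "?F \<bullet> ?h + ?h \<bullet> ?h - ?h \<bullet> A ?h + (s t - q) \<bullet> ?h"
  have "((\<lambda>t. energy q (s t)) has_derivative (\<lambda>r. r * ?D)) (at t within {0..})"
    unfolding energy_def
    by (rule has_derivative_eq_rhs, rule has_derivative_add[OF has_derivative_diff[OF
            half[OF has_derivative_inner[OF Fs Fs]] dist] half[OF has_derivative_inner[OF sq sq]]])
       (auto simp: fun_eq_iff inner_simps inner_commute field_simps)
  then have "((\<lambda>t. energy q (s t)) has_real_derivative ?D) (at t within {0..})"
    unfolding has_field_derivative_def
    by (rule has_derivative_eq_rhs) (rule ext, rule mult.commute)
  moreover have "0 \<le> (?F + ?h) \<bullet> (q - s t - ?h)"
    by (rule residual_variational[OF rest_point_in_K[OF q]])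
  moreover have "0 \<le> A ?h \<bullet> ?h"
    by (rule monotone_derivative_nonneg[OF monotone_F A])
  moreover have "0 \<le> F q \<bullet> (s t - q)"
    using q trajectory_in_K[OF t] by (rule rest_point_variational)
  ultimately show ?thesis
    by (intro exI[of _ ?D] conjI) (auto simp: inner_simps inner_commute algebra_simps)
qed

lemma energy_antimono:
  assumes q: "velocity q = 0" and "0 \<le> a" "a \<le> b"
  shows "energy q (s b) \<le> energy q (s a)"
proof -
  have "\<forall>t. \<exists>D. 0 \<le> t \<longrightarrow> ((\<lambda>t. energy q (s t)) has_real_derivative D) (at t within {0..}) \<and> D \<le> 0"
    using energy_derivative[OF q] monotone_F[of _ q] by (meson neg_le_0_iff_le order_trans)
  then obtain D where D: "\<And>t. 0 \<le> t \<Longrightarrow> D t \<le> 0"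
      "\<And>t. 0 \<le> t \<Longrightarrow> ((\<lambda>t. energy q (s t)) has_real_derivative D t) (at t within {0..})"
    by metis
  have "\<exists>\<xi>\<in>{a..b}. energy q (s b) - energy q (s a) = D \<xi> * (b - a)"
  proof (rule mvt_very_simple[OF \<open>a \<le> b\<close>])
    fix t assume "a \<le> t" "t \<le> b"
    then show "((\<lambda>t. energy q (s t)) has_derivative (\<lambda>h. D t * h)) (at t within {a..b})"
      using D(2)[of t] \<open>0 \<le> a\<close>
      by (auto simp: has_field_derivative_def intro: has_derivative_subset)
  qed
  then obtain \<xi> where "\<xi> \<in> {a..b}" and eq: "energy q (s b) - energy q (s a) = D \<xi> * (b - a)"
    by blast
  then show ?thesis
    using D(1)[of \<xi>] \<open>0 \<le> a\<close> \<open>a \<le> b\<close> mult_nonpos_nonneg[of "D \<xi>" "b - a"] by auto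
qed

lemma bounded_trajectory:
  assumes q: "velocity q = 0"
  shows "bounded (s ` {0..})"
proof -
  have "norm (s t - q) \<le> sqrt (2 * energy q (s 0))" if "0 \<le> t" for t
    using energy_antimono[OF q, of 0 t] energy_ge[OF trajectory_in_K[OF that], of q] that
    by (intro real_le_rsqrt) auto
  then have "s ` {0..} \<subseteq> cball q (sqrt (2 * energy q (s 0)))"
    by (auto simp: dist_norm norm_minus_commute)
  then show ?thesis
    by (rule bounded_subset[OF bounded_cball])
qed

text \<open>
  A bounded trajectory has bounded velocity, so it is Lipschitz in time; this supplies the
  uniform continuity that the Barbalat arguments ask for.
\<close>

lemma uniformly_continuous_along_trajectory:
  fixes h :: "'a \<Rightarrow> 'b::metric_space"
  assumes bdd: "bounded (s ` {0..})" and h: "continuous_on UNIV h"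
  shows "uniformly_continuous_on {0..} (\<lambda>t. h (s t))"
proof -
  have cl: "compact (closure (s ` {0..}))"
    using bdd by (simp add: compact_closure)
  have "compact (velocity ` closure (s ` {0..}))"
    by (rule compact_continuous_image[OF _ cl]) (rule continuous_on_subset[OF continuous_velocity], simp)
  then have "bounded (velocity ` s ` {0..})"
    by (rule bounded_subset[OF compact_imp_bounded]) (intro image_mono closure_subset)
  then obtain C where C: "\<And>t. 0 \<le> t \<Longrightarrow> norm (velocity (s t)) \<le> C"
    unfolding bounded_iff by auto
  have "0 \<le> C" using C[of 0] norm_ge_zero[of "velocity (s 0)"] by linarith
  have "C-lipschitz_on {0..} s"
  proof (rule bounded_derivative_imp_lipschitz)
    show "(s has_derivative (\<lambda>r. r *\<^sub>R velocity (s t))) (at t within {0..})" if "t \<in> {0..}" for t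
      using flow_velocity[of t] that by (simp add: has_vector_derivative_def)
    show "onorm (\<lambda>r. r *\<^sub>R velocity (s t)) \<le> C" if "t \<in> {0..}" for t
      using C[of t] that by (intro onorm_le) (auto simp: mult.commute[of C] intro: mult_left_mono)
  qed (use \<open>0 \<le> C\<close> in auto)
  then have s: "uniformly_continuous_on {0..} s"
    by (rule lipschitz_on_uniformly_continuous)
  have "uniformly_continuous_on (closure (s ` {0..})) h"
    by (rule compact_uniformly_continuous[OF continuous_on_subset[OF h] cl]) simp
  then have "uniformly_continuous_on (s ` {0..}) h"
    using closure_subset unfolding uniformly_continuous_on_def by (meson subsetD)
  then show ?thesis
    using uniformly_continuous_on_compose[OF s] by (simp add: o_def)
qed

lemma monotonicity_gap_tendsto_zero:
  assumes q: "velocity q = 0"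
  shows "((\<lambda>t. (F (s t) - F q) \<bullet> (s t - q)) \<longlongrightarrow> 0) at_top"
proof -
  have "\<forall>t. \<exists>D. 0 \<le> t \<longrightarrow> ((\<lambda>t. energy q (s t)) has_real_derivative D) (at t within {0..}) \<and>
      D \<le> - ((F (s t) - F q) \<bullet> (s t - q))"
    using energy_derivative[OF q] by blast
  then obtain D where D: "\<And>t. 0 \<le> t \<Longrightarrow> D t \<le> - ((F (s t) - F q) \<bullet> (s t - q))"
      "\<And>t. 0 \<le> t \<Longrightarrow> ((\<lambda>t. energy q (s t)) has_real_derivative D t) (at t within {0..})"
    by metis
  show ?thesis
  proof (rule tendsto_zero_of_dissipation[OF D(2) D(1) monotone_F])
    show "0 \<le> energy q (s t)" if "0 \<le> t" for t
      by (rule order_trans[OF _ energy_ge[OF trajectory_in_K[OF that]]]) simp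
    show "uniformly_continuous_on {0..} (\<lambda>t. (F (s t) - F q) \<bullet> (s t - q))"
      by (rule uniformly_continuous_along_trajectory[OF bounded_trajectory[OF q]])
         (intro continuous_intros continuous_F)
  qed
qed

text \<open>
  A bounded trajectory has a limit point \<open>p\<close>, which is a rest point by continuity. The energy relative
  to this very \<open>p\<close> is nonincreasing and tends to zero along a subsequence, hence along the whole
  trajectory, and it dominates the squared distance to \<open>p\<close>.
\<close>

lemma converges_if_velocity_vanishes:
  assumes q: "velocity q = 0"
    and residual: "((\<lambda>t. velocity (s t)) \<longlongrightarrow> 0) at_top"
  obtains p where "velocity p = 0" "(s \<longlongrightarrow> p) at_top"
proof -
  have "compact (closure (s ` {0..}))"
    using bounded_trajectory[OF q] by (simp add: compact_closure)
  moreover have "\<forall>n. s (real n) \<in> closure (s ` {0..})"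
    using closure_subset[of "s ` {0..}"] by auto
  ultimately obtain p r where "strict_mono r" and r: "((\<lambda>n. s (real n)) \<circ> r) \<longlonglongrightarrow> p"
    unfolding compact_def by meson
  have along: "(\<lambda>n. k (s (real (r n)))) \<longlonglongrightarrow> k p" if "continuous_on UNIV k" for k :: "'a \<Rightarrow> 'b::metric_space"
    using continuous_on_tendsto_compose[OF that r] by (simp add: o_def)
  have "filterlim (\<lambda>n. real (r n)) at_top sequentially"
    using filterlim_subseq[OF \<open>strict_mono r\<close>] filterlim_real_sequentially by (rule filterlim_compose[rotated])
  then have "(\<lambda>n. velocity (s (real (r n)))) \<longlonglongrightarrow> 0"
    by (rule filterlim_compose[OF residual])
  then have Hp: "velocity p = 0"
    using along[OF continuous_velocity] LIMSEQ_unique by blast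
  have E: "(\<lambda>n. energy p (s (real (r n)))) \<longlonglongrightarrow> 0"
    using along[OF continuous_energy[of p]] energy_rest_point[OF Hp] by simp
  have "(s \<longlongrightarrow> p) at_top"
  proof (rule tendstoI)
    fix e :: real assume "0 < e"
    then have "\<forall>\<^sub>F n in sequentially. dist (energy p (s (real (r n)))) 0 < e\<^sup>2 / 2"
      by (intro tendstoD[OF E]) simp
    from eventually_happens'[OF sequentially_bot this]
    obtain n where "\<bar>energy p (s (real (r n))) - 0\<bar> < e\<^sup>2 / 2"
      unfolding dist_real_def by blast
    then have n: "energy p (s (real (r n))) < e\<^sup>2 / 2" by linarith
    show "\<forall>\<^sub>F t in at_top. dist (s t) p < e"
    proof (rule eventually_at_top_linorderI)
      fix t assume t: "real (r n) \<le> t"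
      then have "0 \<le> t" by (meson of_nat_0_le_iff order_trans)
      have "(norm (s t - p))\<^sup>2 < e\<^sup>2"
        using energy_ge[OF trajectory_in_K[OF \<open>0 \<le> t\<close>], of p] energy_antimono[OF Hp _ t] n by simp
      then show "dist (s t) p < e"
        using \<open>0 < e\<close> by (simp add: dist_norm power2_less_imp_less)
    qed
  qed
  then show ?thesis using that Hp by blast
qed

end

section \<open>The graph Laplacian\<close>

definition laplacian :: "('n::finite \<times> 'n) set \<Rightarrow> (real ^ 'm) ^ 'n \<Rightarrow> (real ^ 'm) ^ 'n" where
  "laplacian E v = (\<chi> i. \<Sum>j\<in>neighbors E i. v $ i - v $ j)"

lemma linear_laplacian: "linear (laplacian E)"
  by (rule linearI)
     (simp_all only: laplacian_def vec_eq_iff vec_lambda_beta vector_add_component vector_scaleR_component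
       add_diff_add sum.distrib scaleR_diff_right[symmetric] scaleR_sum_right simp_thms)

lemma laplacian_const: "laplacian E (\<chi> i. c) = 0"
  by (simp add: laplacian_def vec_eq_iff)

text \<open>
  Summation by parts over the arcs: symmetry of \<open>E\<close> allows the two ends of an arc to be exchanged, and
  averaging both forms gives the Dirichlet form. Self-adjointness, positivity and the description of
  the kernel are read off from it.
\<close>

lemma inner_laplacian:
  fixes E :: "('n::finite \<times> 'n) set"
  assumes "sym E"
  shows "u \<bullet> laplacian E v = (\<Sum>i\<in>UNIV. \<Sum>j\<in>neighbors E i. (u $ i - u $ j) \<bullet> (v $ i - v $ j)) / 2"
proof -
  let ?S = "\<lambda>g. \<Sum>i\<in>UNIV. \<Sum>j\<in>neighbors E i. g i j"
  have swap: "?S g = ?S (\<lambda>i j. g j i)" for g :: "'n \<Rightarrow> 'n \<Rightarrow> real"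
  proof -
    have "neighbors E i = {j. j \<in> UNIV \<and> (i, j) \<in> E}" for i
      using assms by (auto simp: neighbors_def dest: symD)
    then have "?S g = (\<Sum>j\<in>UNIV. \<Sum>i\<in>{i. i \<in> UNIV \<and> (i, j) \<in> E}. g i j)"
      using sum.swap_restrict[of UNIV UNIV g "\<lambda>i j. (i, j) \<in> E"] by simp
    then show ?thesis by (simp add: neighbors_def)
  qed
  have "u \<bullet> laplacian E v = ?S (\<lambda>i j. u $ i \<bullet> (v $ i - v $ j))"
    by (simp add: laplacian_def inner_vec_def[of u] inner_sum_right)
  moreover have "\<dots> = ?S (\<lambda>i j. u $ j \<bullet> (v $ j - v $ i))"
    by (rule swap)
  moreover have "?S (\<lambda>i j. (u $ i - u $ j) \<bullet> (v $ i - v $ j)) =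
      ?S (\<lambda>i j. u $ i \<bullet> (v $ i - v $ j)) + ?S (\<lambda>i j. u $ j \<bullet> (v $ j - v $ i))"
    by (simp add: sum.distrib[symmetric] inner_diff algebra_simps)
  ultimately show ?thesis by simp
qed

lemma laplacian_self_adjoint:
  assumes "sym E"
  shows "u \<bullet> laplacian E v = laplacian E u \<bullet> v"
  using inner_laplacian[OF assms, of u v] inner_laplacian[OF assms, of v u]
  by (simp add: inner_commute)

lemma laplacian_nonneg:
  assumes "sym E"
  shows "0 \<le> v \<bullet> laplacian E v"
  by (auto simp: inner_laplacian[OF assms] intro!: sum_nonneg)

text \<open>
  A vanishing Dirichlet form makes \<open>v\<close> agree across every arc, and connectedness propagates the
  agreement along paths.
\<close>

lemma laplacian_kernel:
  assumes E: "undirected_connected E" and 0: "v \<bullet> laplacian E v = 0"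
  shows "v $ i = v $ j"
proof -
  have "sym E" and conn: "(i, j) \<in> E\<^sup>*"
    using E by (auto simp: undirected_connected_def)
  have nonneg: "0 \<le> (\<Sum>j\<in>neighbors E i. (v $ i - v $ j) \<bullet> (v $ i - v $ j))" for i
    by (intro sum_nonneg) auto
  have "(\<Sum>i\<in>UNIV. \<Sum>j\<in>neighbors E i. (v $ i - v $ j) \<bullet> (v $ i - v $ j)) = 0"
    using 0 by (simp add: inner_laplacian[OF \<open>sym E\<close>])
  then have "(\<Sum>j\<in>neighbors E i. (v $ i - v $ j) \<bullet> (v $ i - v $ j)) = 0" for i
    using nonneg by (simp add: sum_nonneg_eq_0_iff)
  then have edge: "v $ i = v $ j" if "j \<in> neighbors E i" for i j
    using that sum_nonneg_eq_0_iff[of "neighbors E i" "\<lambda>j. (v $ i - v $ j) \<bullet> (v $ i - v $ j)"]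
    by (simp add: finite_subset[OF subset_UNIV])
  from conn show ?thesis
    by (induction rule: rtrancl_induct) (auto dest!: edge[unfolded neighbors_def, OF CollectI])
qed

lemma sum_laplacian:
  fixes v :: "(real ^ 'm) ^ 'n"
  assumes "sym E"
  shows "(\<Sum>i\<in>UNIV. laplacian E v $ i) = 0"
proof -
  have "c \<bullet> (\<Sum>i\<in>UNIV. laplacian E v $ i) = 0" for c
    using laplacian_self_adjoint[OF assms, of "\<chi> i. c" v]
    by (simp add: laplacian_const inner_vec_def[of "\<chi> i. c"] inner_sum_right)
  then show ?thesis
    by (metis inner_eq_zero_iff)
qed

lemma laplacian_eq_zero_imp_zero:
  fixes w :: "(real ^ 'm) ^ 'n"
  assumes E: "undirected_connected E" and "laplacian E w = 0" and sum: "(\<Sum>i\<in>UNIV. w $ i) = 0"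
  shows "w = 0"
proof -
  have "w $ j = 0" for j
  proof -
    have "(\<Sum>i\<in>UNIV. w $ i) = (\<Sum>i\<in>(UNIV :: 'n set). w $ j)"
      using laplacian_kernel[OF E, of w] assms(2) by (intro sum.cong) auto
    then show ?thesis using sum by (simp add: sum_constant_scaleR del: sum_constant)
  qed
  then show ?thesis by (simp add: vec_eq_iff)
qed

text \<open>
  By self-adjointness the range is the orthogonal complement of the kernel, that is, of the constant
  vectors.
\<close>

lemma laplacian_solvable:
  fixes w :: "(real ^ 'm) ^ 'n"
  assumes E: "undirected_connected E" and sum: "(\<Sum>i\<in>UNIV. w $ i) = 0"
  obtains v where "laplacian E v = w"
proof -
  have "sym E" using E by (simp add: undirected_connected_def)
  have lin: "linear (laplacian E :: (real ^ 'm) ^ 'n \<Rightarrow> _)" by (rule linear_laplacian)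
  have "adjoint (laplacian E :: (real ^ 'm) ^ 'n \<Rightarrow> _) = laplacian E"
    by (rule adjoint_unique) (simp add: laplacian_self_adjoint[OF \<open>sym E\<close>])
  then have "(laplacian E :: (real ^ 'm) ^ 'n \<Rightarrow> _) -` {0} = (range (laplacian E))\<^sup>\<bottom>"
    using ker_orthogonal_comp_adjoint[OF lin] by simp
  then have range: "((laplacian E :: (real ^ 'm) ^ 'n \<Rightarrow> _) -` {0})\<^sup>\<bottom> = range (laplacian E)"
    by (simp add: orthogonal_comp_self linear_subspace_image lin)
  have "v \<bullet> w = 0" if "laplacian E v = 0" for v :: "(real ^ 'm) ^ 'n"
  proof -
    \<comment> \<open>\<open>undefined\<close> serves as an arbitrary agent.\<close>
    have const: "v $ i = v $ undefined" for i
      using laplacian_kernel[OF E, of v i undefined] that by simp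
    have "v \<bullet> w = v $ undefined \<bullet> (\<Sum>i\<in>UNIV. w $ i)"
      unfolding inner_vec_def[of v] inner_sum_right
      by (intro sum.cong refl arg_cong2[where f = inner] const)
    then show ?thesis using sum by simp
  qed
  then have "w \<in> (laplacian E -` {0})\<^sup>\<bottom>"
    by (auto simp: orthogonal_comp_def orthogonal_def)
  then show ?thesis using range that by auto
qed

section \<open>Projections onto products\<close>

lemma closest_point_eqI:
  fixes K :: "'a::euclidean_space set"
  assumes "convex K" "closed K" "p \<in> K" and "\<And>y. y \<in> K \<Longrightarrow> (a - p) \<bullet> (y - p) \<le> 0"
  shows "closest_point K a = p"
proof -
  have "dist a p \<le> dist a y" if "y \<in> K" for y
  proof -
    have "(a - p) \<bullet> (a - p) \<le> (a - y) \<bullet> (a - y)"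
      using assms(4)[OF that] inner_ge_zero[of "y - p"]
      by (simp add: inner_diff inner_commute)
    then show ?thesis by (simp add: dist_norm norm_le)
  qed
  then show ?thesis
    using closest_point_unique[OF assms(1-3)] by metis
qed

lemma convex_vec_product:
  assumes "\<And>i. convex (\<Omega> i)"
  shows "convex {v :: ('a::real_vector) ^ 'n. \<forall>i. v $ i \<in> \<Omega> i}"
  using assms by (auto simp: convex_def)

lemma closed_vec_product:
  assumes "\<And>i. closed (\<Omega> i)"
  shows "closed {v :: ('a::topological_space) ^ 'n::finite. \<forall>i. v $ i \<in> \<Omega> i}"
proof -
  have "{v :: 'a ^ 'n. \<forall>i. v $ i \<in> \<Omega> i} = (\<Inter>i. (\<lambda>v. v $ i) -` \<Omega> i)" by auto
  moreover have "closed ((\<lambda>v :: 'a ^ 'n. v $ i) -` \<Omega> i)" for i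
    using assms by (intro closed_vimage continuous_intros) 
  ultimately show ?thesis by auto
qed

lemma closest_point_vec_product:
  fixes \<Omega> :: "'n::finite \<Rightarrow> ('a::euclidean_space) set"
  assumes "\<And>i. convex (\<Omega> i)" "\<And>i. closed (\<Omega> i)" "\<And>i. \<Omega> i \<noteq> {}"
  shows "closest_point {v. \<forall>i. v $ i \<in> \<Omega> i} a = (\<chi> i. closest_point (\<Omega> i) (a $ i))"
  using assms
  by (intro closest_point_eqI convex_vec_product closed_vec_product)
     (auto simp: inner_vec_def closest_point_in_set closest_point_dot intro!: sum_nonpos)

lemma closest_point_Times_UNIV:
  fixes K :: "'a::euclidean_space set" and b :: "'b::euclidean_space"
  assumes "convex K" "closed K" "K \<noteq> {}"
  shows "closest_point (K \<times> UNIV) (a, b) = (closest_point K a, b)"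
  using assms
  by (intro closest_point_eqI convex_Times closed_Times)
     (auto simp: closest_point_in_set closest_point_dot)

section \<open>Componentwise derivatives and strictly monotone gradients\<close>

lemma has_derivative_vec_lambda:
  fixes f :: "'n::finite \<Rightarrow> 'a::real_normed_vector \<Rightarrow> 'b::euclidean_space"
  assumes "\<And>i. (f i has_derivative f' i) (at x within S)"
  shows "((\<lambda>x. \<chi> i. f i x) has_derivative (\<lambda>h. \<chi> i. f' i h)) (at x within S)"
proof -
  have "linear (axis i :: 'b \<Rightarrow> 'b ^ 'n)" for i
    by (rule linearI) (auto simp: axis_def vec_eq_iff)
  then have "bounded_linear (axis i :: 'b \<Rightarrow> 'b ^ 'n)" for i
    by (simp add: linear_conv_bounded_linear)
  then have "((\<lambda>x. \<Sum>i\<in>UNIV. axis i (f i x) :: 'b ^ 'n) has_derivative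
      (\<lambda>h. \<Sum>i\<in>UNIV. axis i (f' i h))) (at x within S)"
    by (intro has_derivative_sum) (rule bounded_linear.has_derivative, assumption, rule assms)
  moreover have "(\<Sum>i\<in>UNIV. axis i (g i)) = (\<chi> i. g i)" for g :: "'n \<Rightarrow> 'b"
    by (simp add: vec_eq_iff axis_def if_distrib sum.delta cong: if_cong)
  ultimately show ?thesis by simp
qed

lemma differentiable_vec_lambda:
  fixes f :: "'n::finite \<Rightarrow> 'a::real_normed_vector \<Rightarrow> 'b::euclidean_space"
  assumes "\<And>i. f i differentiable (at x)"
  shows "(\<lambda>x. \<chi> i. f i x) differentiable (at x)"
proof -
  have "\<forall>i. \<exists>D. (f i has_derivative D) (at x)"
    using assms by (simp add: differentiable_def)
  then obtain D where "\<And>i. (f i has_derivative D i) (at x)" by metis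
  then have "((\<lambda>x. \<chi> i. f i x) has_derivative (\<lambda>h. \<chi> i. D i h)) (at x)"
    by (rule has_derivative_vec_lambda)
  then show ?thesis
    unfolding differentiable_def by blast
qed

lemma has_vector_derivative_vec_lambda:
  fixes f :: "'n::finite \<Rightarrow> real \<Rightarrow> 'b::euclidean_space"
  assumes "\<And>i. (f i has_vector_derivative f' i) (at t within S)"
  shows "((\<lambda>t. \<chi> i. f i t) has_vector_derivative (\<chi> i. f' i)) (at t within S)"
  using has_derivative_vec_lambda[OF assms[unfolded has_vector_derivative_def]]
  unfolding has_vector_derivative_def
  by (rule has_derivative_eq_rhs) (simp add: fun_eq_iff vec_eq_iff)

text \<open>
  Along the segment from \<open>y\<close> to \<open>x\<close> the component of the gradient in direction \<open>x - y\<close> has the Hessian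
  form as its derivative, which is positive.
\<close>

lemma grad_strict_mono:
  assumes f: "regular_objective f" and "x \<noteq> y"
  shows "0 < (grad f x - grad f y) \<bullet> (x - y)"
proof -
  define v where "v = x - y"
  let ?\<phi> = "\<lambda>r::real. grad f (y + r *\<^sub>R v) \<bullet> v"
  have pos: "\<exists>D. (?\<phi> has_real_derivative D) (at r) \<and> 0 < D" for r
  proof -
    let ?p = "y + r *\<^sub>R v"
    have "(grad f has_derivative (\<lambda>h. hessian f ?p *v h)) (at ?p)"
      using f by (simp add: regular_objective_def hessian_def jacobian_works[symmetric])
    moreover have "((\<lambda>r. y + r *\<^sub>R v) has_derivative (\<lambda>h. h *\<^sub>R v)) (at r)"
      by (auto intro!: derivative_eq_intros)
    ultimately have "((\<lambda>r. grad f (y + r *\<^sub>R v)) has_derivative (\<lambda>h. hessian f ?p *v (h *\<^sub>R v))) (at r)"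
      by (rule has_derivative_compose[rotated])
    then have "(?\<phi> has_derivative (\<lambda>h. (hessian f ?p *v (h *\<^sub>R v)) \<bullet> v)) (at r)"
      by (rule has_derivative_inner_left)
    moreover have "(hessian f ?p *v (h *\<^sub>R v)) \<bullet> v = (v \<bullet> (hessian f ?p *v v)) * h" for h
      by (simp add: matrix_vector_mult_scaleR inner_commute)
    ultimately have "(?\<phi> has_real_derivative v \<bullet> (hessian f ?p *v v)) (at r)"
      by (simp add: has_field_derivative_def)
    moreover have "0 < v \<bullet> (hessian f ?p *v v)"
      using f \<open>x \<noteq> y\<close> by (simp add: regular_objective_def positive_definite_def v_def)
    ultimately show ?thesis by blast
  qed
  have "?\<phi> 0 < ?\<phi> 1"
    by (rule DERIV_pos_imp_increasing[OF zero_less_one]) (rule pos)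
  then show ?thesis by (simp add: v_def inner_diff_left)
qed

section \<open>Lagrange multipliers\<close>

text \<open>
  The objective restricted to the segment from \<open>X\<close> to the feasible \<open>y\<close> cannot have a negative
  derivative at \<open>X\<close>.
\<close>

lemma optimal_allocation_variational:
  assumes f: "\<And>i x. f i differentiable (at x)" and \<Omega>: "\<And>i. convex (\<Omega> i)"
    and X: "optimal_allocation \<Omega> d f X" and y: "y \<in> feasible \<Omega> d"
  shows "0 \<le> (\<Sum>i\<in>UNIV. grad (f i) (X $ i) \<bullet> (y $ i - X $ i))"
proof (rule ccontr)
  let ?\<phi> = "\<lambda>r. \<Sum>i\<in>UNIV. f i (X $ i + r *\<^sub>R (y $ i - X $ i))"
  let ?D = "\<Sum>i\<in>UNIV. grad (f i) (X $ i) \<bullet> (y $ i - X $ i)"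
  assume "\<not> 0 \<le> ?D"
  have "((\<lambda>r. f i (X $ i + r *\<^sub>R (y $ i - X $ i))) has_real_derivative
      grad (f i) (X $ i) \<bullet> (y $ i - X $ i)) (at 0)" for i
  proof -
    have "(f i has_derivative (\<lambda>h. h \<bullet> grad (f i) (X $ i))) (at (X $ i + 0 *\<^sub>R (y $ i - X $ i)))"
      using differentiable_imp_GDERIV_grad[OF f] by (simp add: gderiv_def)
    moreover have "((\<lambda>r. X $ i + r *\<^sub>R (y $ i - X $ i)) has_derivative (\<lambda>h. h *\<^sub>R (y $ i - X $ i))) (at 0)"
      by (auto intro!: derivative_eq_intros)
    ultimately have "((\<lambda>r. f i (X $ i + r *\<^sub>R (y $ i - X $ i))) has_derivative
        (\<lambda>h. (h *\<^sub>R (y $ i - X $ i)) \<bullet> grad (f i) (X $ i))) (at 0)"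
      by (rule has_derivative_compose[rotated])
    then show ?thesis
      unfolding has_field_derivative_def
      by (rule has_derivative_eq_rhs) (simp add: fun_eq_iff inner_commute)
  qed
  then have "(?\<phi> has_real_derivative ?D) (at 0)"
    by (intro DERIV_sum)
  then obtain e where "0 < e" and e: "\<And>h. \<lbrakk>0 < h; h < e\<rbrakk> \<Longrightarrow> ?\<phi> h < ?\<phi> 0"
    using DERIV_neg_dec_right[of ?\<phi> ?D 0] \<open>\<not> 0 \<le> ?D\<close> by auto
  define r where "r = min (e / 2) 1"
  have r: "0 < r" "r < e" "r \<le> 1" using \<open>0 < e\<close> by (auto simp: r_def)
  have Xf: "X \<in> feasible \<Omega> d" and min: "\<And>y. y \<in> feasible \<Omega> d \<Longrightarrow> \<not> (\<Sum>i\<in>UNIV. f i (y $ i)) < (\<Sum>i\<in>UNIV. f i (X $ i))"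
    using X by (auto simp: optimal_allocation_def is_arg_min_def)
  have "X + r *\<^sub>R (y - X) \<in> feasible \<Omega> d"
  proof -
    have "X $ i + r *\<^sub>R (y $ i - X $ i) \<in> \<Omega> i" for i
    proof -
      have "(1 - r) *\<^sub>R (X $ i) + r *\<^sub>R (y $ i) \<in> \<Omega> i"
        using Xf y r by (intro convexD_alt[OF \<Omega>]) (auto simp: feasible_def)
      then show ?thesis by (simp add: algebra_simps)
    qed
    moreover have "(\<Sum>i\<in>UNIV. X $ i + r *\<^sub>R (y $ i - X $ i)) = (\<Sum>i\<in>UNIV. d i)"
      using Xf y by (simp add: feasible_def sum.distrib sum_subtractf scaleR_sum_right[symmetric])
    ultimately show ?thesis by (simp add: feasible_def)
  qed
  from min[OF this] e[OF r(1,2)] show False by simp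
qed

text \<open>
  The pairs formed by the resource imbalance of a displacement \<open>h\<close> and any number above its linear
  cost make up a convex set which misses the origin by minimality of \<open>X\<close>. The last component
  \<open>\<alpha>\<close> of a separating normal is nonzero: otherwise the normal would bound all imbalances
  on one side, but the Slater point can be moved by a small multiple of \<open>- \<nu>\<close> in one coordinate.
  Dividing by \<open>\<alpha>\<close> gives the price \<open>\<mu>\<close>, and displacements of a single agent separate the inequality
  into one for each agent.
\<close>

lemma lagrange_multiplier:
  fixes \<Omega> :: "'n::finite \<Rightarrow> (real ^ 'm) set" and X :: "(real ^ 'm) ^ 'n"
  assumes \<Omega>: "\<And>i. convex (\<Omega> i)" and slater: "slater_condition \<Omega> d" and X: "X \<in> feasible \<Omega> d"
    and min: "\<And>y. y \<in> feasible \<Omega> d \<Longrightarrow> 0 \<le> (\<Sum>i\<in>UNIV. c i \<bullet> (y $ i - X $ i))"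
  shows "\<exists>\<mu>. \<forall>i. \<forall>y\<in>\<Omega> i. 0 \<le> (c i - \<mu>) \<bullet> (y - X $ i)"
proof -
  define A where "A = {h :: (real ^ 'm) ^ 'n. \<forall>i. X $ i + h $ i \<in> \<Omega> i}"
  define \<sigma> :: "(real ^ 'm) ^ 'n \<Rightarrow> real ^ 'm" where "\<sigma> h = (\<Sum>i\<in>UNIV. h $ i)" for h
  define l where "l h = (\<Sum>i\<in>UNIV. c i \<bullet> h $ i)" for h :: "(real ^ 'm) ^ 'n"
  have comb: "\<sigma> (a *\<^sub>R g + b *\<^sub>R h) = a *\<^sub>R \<sigma> g + b *\<^sub>R \<sigma> h" "l (a *\<^sub>R g + b *\<^sub>R h) = a * l g + b * l h"
    for a b g h
    by (simp_all add: \<sigma>_def l_def sum.distrib scaleR_sum_right sum_distrib_left inner_add_right)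
  have XA: "X $ i \<in> \<Omega> i" for i using X by (simp add: feasible_def)
  have A_conv: "a *\<^sub>R g + b *\<^sub>R h \<in> A" if "g \<in> A" "h \<in> A" "0 \<le> a" "0 \<le> b" "a + b = 1" for a b g h
  proof -
    have "a *\<^sub>R (X $ i + g $ i) + b *\<^sub>R (X $ i + h $ i) \<in> \<Omega> i" for i
      using that by (intro convexD[OF \<Omega>]) (auto simp: A_def)
    moreover have "a *\<^sub>R (X $ i + g $ i) + b *\<^sub>R (X $ i + h $ i) =
        X $ i + (a *\<^sub>R g $ i + b *\<^sub>R h $ i)" for i
      using scaleR_add_left[of a b "X $ i"] that(5) by (simp add: algebra_simps)
    ultimately show ?thesis by (simp add: A_def)
  qed
  \<comment> \<open>A strictly positive surplus \<open>e\<close> keeps the origin, the image of \<open>h = 0\<close> without surplus, out of the set.\<close>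
  define C where "C = {(\<sigma> h, l h + e) | h e. h \<in> A \<and> 0 < e}"
  have "convex C"
  proof (rule convexI)
    fix p q and a b :: real
    assume "p \<in> C" "q \<in> C" and ab: "0 \<le> a" "0 \<le> b" "a + b = 1"
    then obtain g e h e' where p: "p = (\<sigma> g, l g + e)" "g \<in> A" "0 < e"
      and q: "q = (\<sigma> h, l h + e')" "h \<in> A" "0 < e'"
      unfolding C_def by blast
    have "a * e + b * e' \<in> {0<..}"
      using convexD[OF convex_real_interval(3)[of 0], of e e' a b] p q ab by simp
    moreover have "a *\<^sub>R p + b *\<^sub>R q =
        (\<sigma> (a *\<^sub>R g + b *\<^sub>R h), l (a *\<^sub>R g + b *\<^sub>R h) + (a * e + b * e'))"
      by (simp add: p q comb algebra_simps)
    ultimately show "a *\<^sub>R p + b *\<^sub>R q \<in> C"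
      unfolding C_def using A_conv[OF p(2) q(2) ab] by blast
  qed
  moreover have "0 \<notin> C"
  proof
    assume "0 \<in> C"
    then obtain h e where h: "h \<in> A" "\<sigma> h = 0" "l h + e = 0" and "0 < e"
      unfolding C_def by (auto simp: zero_prod_def)
    then have "X + h \<in> feasible \<Omega> d"
      using X by (simp add: feasible_def A_def \<sigma>_def sum.distrib)
    from min[OF this] have "0 \<le> l h" by (simp add: l_def)
    with h \<open>0 < e\<close> show False by simp
  qed
  ultimately obtain n where "n \<noteq> 0" and n: "\<forall>p\<in>C. 0 \<le> n \<bullet> p"
    using separating_hyperplane_set_0 by blast
  obtain \<nu> \<alpha> where n_eq: "n = (\<nu>, \<alpha>)" by force
  have sep: "0 \<le> \<nu> \<bullet> \<sigma> h + \<alpha> * (l h + e)" if "h \<in> A" "0 < e" for h e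
    using n that unfolding C_def n_eq by force
  have "0 \<in> A" using XA by (simp add: A_def)
  from sep[OF this, of 1] have "0 \<le> \<alpha>" by (simp add: \<sigma>_def l_def)
  \<comment> \<open>Let the surplus tend to zero; the summand 1 avoids a division by zero.\<close>
  have sep0: "0 \<le> \<nu> \<bullet> \<sigma> h + \<alpha> * l h" if "h \<in> A" for h
  proof (rule field_le_epsilon)
    fix e :: real assume "0 < e"
    have "\<alpha> * (e / (\<alpha> + 1)) \<le> e"
      using \<open>0 \<le> \<alpha>\<close> \<open>0 < e\<close> by (simp add: field_simps)
    moreover have "0 < e / (\<alpha> + 1)" using \<open>0 \<le> \<alpha>\<close> \<open>0 < e\<close> by simp
    ultimately show "0 \<le> \<nu> \<bullet> \<sigma> h + \<alpha> * l h + e"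
      using sep[OF that, of "e / (\<alpha> + 1)"] by (simp add: distrib_left)
  qed
  have "\<alpha> \<noteq> 0"
  proof
    assume "\<alpha> = 0"
    obtain w where w: "\<And>i. w i \<in> interior (\<Omega> i)" and sum_w: "(\<Sum>i\<in>UNIV. w i) = (\<Sum>i\<in>UNIV. d i)"
      using slater by (auto simp: slater_condition_def)
    fix k :: 'n
    obtain \<rho> where "0 < \<rho>" and \<rho>: "ball (w k) \<rho> \<subseteq> \<Omega> k"
      using w[of k] by (auto simp: mem_interior)
    \<comment> \<open>The summand 1 covers \<open>\<nu> = 0\<close>, which is not yet excluded.\<close>
    define \<epsilon> where "\<epsilon> = \<rho> / (norm \<nu> + 1)"
    have "0 < \<epsilon>" using \<open>0 < \<rho>\<close> by (simp add: \<epsilon>_def add_nonneg_pos)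
    have "\<epsilon> * norm \<nu> < \<epsilon> * (norm \<nu> + 1)" using \<open>0 < \<epsilon>\<close> by simp
    also have "\<dots> = \<rho>"
      using norm_ge_zero[of \<nu>] by (simp add: \<epsilon>_def add_nonneg_eq_0_iff)
    finally have "\<epsilon> * norm \<nu> < \<rho>" .
    then have "w k - \<epsilon> *\<^sub>R \<nu> \<in> \<Omega> k"
      using \<rho> \<open>0 < \<epsilon>\<close> by (intro subsetD[OF \<rho>]) (simp add: dist_norm)
    define h where "h = (\<chi> i. w i - X $ i) - axis k (\<epsilon> *\<^sub>R \<nu>)"
    have "h \<in> A"
      using w interior_subset \<open>w k - \<epsilon> *\<^sub>R \<nu> \<in> \<Omega> k\<close> by (auto simp: A_def h_def axis_def)
    moreover have "\<sigma> h = - (\<epsilon> *\<^sub>R \<nu>)"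
      using X sum_w by (simp add: \<sigma>_def h_def sum_subtractf axis_def feasible_def)
    ultimately have "\<epsilon> * (\<nu> \<bullet> \<nu>) \<le> 0"
      using sep0[of h] \<open>\<alpha> = 0\<close> by simp
    then have "\<nu> = 0" using \<open>0 < \<epsilon>\<close> by (metis inner_gt_zero_iff mult_pos_pos not_le)
    then show False using \<open>\<alpha> = 0\<close> \<open>n \<noteq> 0\<close> by (simp add: n_eq zero_prod_def)
  qed
  then have "0 < \<alpha>" using \<open>0 \<le> \<alpha>\<close> by simp
  show ?thesis
  proof (intro exI[of _ "- (1 / \<alpha>) *\<^sub>R \<nu>"] allI ballI)
    fix i y assume "y \<in> \<Omega> i"
    let ?h = "axis i (y - X $ i) :: (real ^ 'm) ^ 'n"
    have "?h \<in> A" using \<open>y \<in> \<Omega> i\<close> XA by (auto simp: A_def axis_def)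
    from sep0[OF this] have "0 \<le> \<nu> \<bullet> (y - X $ i) + \<alpha> * (c i \<bullet> (y - X $ i))"
      by (simp add: \<sigma>_def l_def axis_def if_distrib cong: if_cong)
    then show "0 \<le> (c i - - (1 / \<alpha>) *\<^sub>R \<nu>) \<bullet> (y - X $ i)"
      using \<open>0 < \<alpha>\<close> by (simp add: inner_add_left field_simps)
  qed
qed

section \<open>The algorithm as a projected flow\<close>

type_synonym ('m, 'n) state = "((real ^ 'm) ^ 'n) \<times> ((real ^ 'm) ^ 'n) \<times> ((real ^ 'm) ^ 'n)"

text \<open>
  The gradient in \<open>x\<close> and \<open>z\<close> and the negative gradient in \<open>lam\<close> of the augmented Lagrangian
  \<open>sum f + lam \<bullet> (d - x) - lam \<bullet> laplacian lam / 2 - lam \<bullet> laplacian z\<close>.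
\<close>

definition saddle_map ::
  "('n::finite \<times> 'n) set \<Rightarrow> ('n \<Rightarrow> real ^ 'm) \<Rightarrow> ('n \<Rightarrow> real ^ 'm \<Rightarrow> real) \<Rightarrow>
    ('m, 'n) state \<Rightarrow> ('m, 'n) state" where
  "saddle_map E d f = (\<lambda>(x, lam, z).
     ((\<chi> i. grad (f i) (x $ i) - lam $ i),
      laplacian E lam + laplacian E z - (\<chi> i. d i) + x,
      - laplacian E lam))"

definition state_constraint :: "('n::finite \<Rightarrow> (real ^ 'm) set) \<Rightarrow> ('m, 'n) state set" where
  "state_constraint \<Omega> = {x. \<forall>i. x $ i \<in> \<Omega> i} \<times> UNIV"

definition projected_field ::
  "('n::finite \<times> 'n) set \<Rightarrow> ('n \<Rightarrow> (real ^ 'm) set) \<Rightarrow> ('n \<Rightarrow> real ^ 'm) \<Rightarrow>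
    ('n \<Rightarrow> real ^ 'm \<Rightarrow> real) \<Rightarrow> ('m, 'n) state \<Rightarrow> ('m, 'n) state" where
  "projected_field E \<Omega> d f p = closest_point (state_constraint \<Omega>) (p - saddle_map E d f p) - p"

text \<open>
  Projecting onto a product acts on each agent separately and leaves the free dual variables alone, so
  the projected field is the right-hand side of the algorithm.
\<close>

lemma projected_field_eq:
  fixes \<Omega> :: "'n::finite \<Rightarrow> (real ^ 'm) set"
  assumes "\<And>i. convex (\<Omega> i)" "\<And>i. closed (\<Omega> i)" "\<And>i. \<Omega> i \<noteq> {}"
  shows "projected_field E \<Omega> d f (x, lam, z) =
    ((\<chi> i. x_rhs \<Omega> f x lam i), (\<chi> i. lambda_rhs E d x lam z i), (\<chi> i. z_rhs E lam i))"
proof -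
  have "(\<chi> i. SOME y. y \<in> \<Omega> i) \<in> {v. \<forall>i. v $ i \<in> \<Omega> i}"
    using assms(3) by (auto simp: some_in_eq)
  then have "{v. \<forall>i. v $ i \<in> \<Omega> i} \<noteq> {}" by blast
  then show ?thesis
    unfolding projected_field_def state_constraint_def saddle_map_def
    using assms
    by (simp add: closest_point_Times_UNIV convex_vec_product closed_vec_product
        closest_point_vec_product)
       (auto simp: vec_eq_iff x_rhs_def lambda_rhs_def z_rhs_def laplacian_def algebra_simps)
qed

text \<open>
  The couplings between \<open>x\<close> and \<open>lam\<close> and between \<open>lam\<close> and \<open>z\<close> are skew and cancel; what remains is
  the monotonicity of the gradients and the Dirichlet form of \<open>lam\<close>.
\<close>

lemma saddle_map_gap:
  fixes E :: "('n::finite \<times> 'n) set" and x lam z x' lam' z' :: "(real ^ 'm) ^ 'n"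
  assumes "sym E"
  shows "(saddle_map E d f (x, lam, z) - saddle_map E d f (x', lam', z')) \<bullet> ((x, lam, z) - (x', lam', z')) =
    (\<Sum>i\<in>UNIV. (grad (f i) (x $ i) - grad (f i) (x' $ i)) \<bullet> (x $ i - x' $ i)) +
    (lam - lam') \<bullet> laplacian E (lam - lam')"
proof -
  have L: "laplacian E (u - v) = laplacian E u - laplacian E v" for u v :: "(real ^ 'm) ^ 'n"
    by (rule linear_diff[OF linear_laplacian])
  have adj: "laplacian E u \<bullet> v = u \<bullet> laplacian E v" for u v :: "(real ^ 'm) ^ 'n"
    using laplacian_self_adjoint[OF assms, of u v] by simp
  let ?g = "\<chi> i. grad (f i) (x $ i) - grad (f i) (x' $ i)"
  have "saddle_map E d f (x, lam, z) - saddle_map E d f (x', lam', z') =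
      (?g - (lam - lam'), laplacian E (lam - lam') + laplacian E (z - z') + (x - x'),
       - laplacian E (lam - lam'))"
    by (simp add: saddle_map_def L) (simp add: vec_eq_iff)
  moreover have "?g \<bullet> (x - x') =
      (\<Sum>i\<in>UNIV. (grad (f i) (x $ i) - grad (f i) (x' $ i)) \<bullet> (x $ i - x' $ i))"
    by (simp add: inner_vec_def[of _ "x - x'"])
  moreover have "(?g - a) \<bullet> y + ((laplacian E a + laplacian E b + y) \<bullet> a - laplacian E a \<bullet> b) =
      ?g \<bullet> y + a \<bullet> laplacian E a" for a b y
    using adj[of b a]
    by (simp add: inner_add_left inner_diff_left inner_commute[of y a] inner_commute[of b]
        inner_commute[of a "laplacian E a"])
  ultimately show ?thesis by simp
qed

locale resource_allocation =
  fixes E :: "('n::finite \<times> 'n) set"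
    and \<Omega> :: "'n \<Rightarrow> (real ^ 'm) set"
    and d :: "'n \<Rightarrow> real ^ 'm"
    and f :: "'n \<Rightarrow> real ^ 'm \<Rightarrow> real"
  assumes closed_\<Omega>: "\<And>i. closed (\<Omega> i)" and convex_\<Omega>: "\<And>i. convex (\<Omega> i)"
    and objective: "\<And>i. regular_objective (f i)"
    and slater: "slater_condition \<Omega> d"
    and graph: "undirected_connected E"
begin

lemma sym_graph: "sym E"
  using graph by (simp add: undirected_connected_def)

lemma nonempty_\<Omega>: "\<Omega> i \<noteq> {}"
  using slater interior_subset by (fastforce simp: slater_condition_def)

lemma equilibrium_iff_projected_field:
  "equilibrium E \<Omega> d f x lam z \<longleftrightarrow> projected_field E \<Omega> d f (x, lam, z) = 0"
  by (auto simp: equilibrium_def projected_field_eq[OF convex_\<Omega> closed_\<Omega> nonempty_\<Omega>] zero_prod_def vec_eq_iff)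

text \<open>
  The dual variables of the equilibrium are the multiplier, shared by all agents, and a potential \<open>z\<close>
  whose Laplacian is the local imbalance \<open>d - X\<close>; such a \<open>z\<close> exists because the total imbalance is zero.
\<close>

lemma optimal_imp_equilibrium:
  assumes "optimal_allocation \<Omega> d f X"
  obtains lam z where "equilibrium E \<Omega> d f X lam z"
proof -
  have X: "X \<in> feasible \<Omega> d"
    using assms by (simp add: optimal_allocation_def is_arg_min_def)
  have "0 \<le> (\<Sum>i\<in>UNIV. grad (f i) (X $ i) \<bullet> (y $ i - X $ i))" if "y \<in> feasible \<Omega> d" for y
    using optimal_allocation_variational[OF _ convex_\<Omega> assms that] objective
    by (simp add: regular_objective_def)
  from lagrange_multiplier[OF convex_\<Omega> slater X this]
  obtain \<mu> where \<mu>: "\<And>i y. y \<in> \<Omega> i \<Longrightarrow> 0 \<le> (grad (f i) (X $ i) - \<mu>) \<bullet> (y - X $ i)"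
    by blast
  have "(\<Sum>i\<in>UNIV. ((\<chi> i. d i) - X) $ i) = 0"
    using X by (simp add: feasible_def sum_subtractf)
  then obtain z where z: "laplacian E z = (\<chi> i. d i) - X"
    by (rule laplacian_solvable[OF graph])
  have "closest_point (\<Omega> i) (X $ i - grad (f i) (X $ i) + \<mu>) = X $ i" for i
  proof (rule closest_point_eqI[OF convex_\<Omega> closed_\<Omega>])
    show "X $ i \<in> \<Omega> i" using X by (simp add: feasible_def)
    show "(X $ i - grad (f i) (X $ i) + \<mu> - X $ i) \<bullet> (y - X $ i) \<le> 0" if "y \<in> \<Omega> i" for y
      using \<mu>[OF that] by (simp add: inner_diff_left inner_add_left)
  qed
  moreover have "(\<Sum>j\<in>neighbors E i. z $ i - z $ j) = d i - X $ i" for i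
    using arg_cong[OF z, of "\<lambda>v. v $ i"] by (simp add: laplacian_def)
  ultimately have "equilibrium E \<Omega> d f X (\<chi> i. \<mu>) z"
    by (simp add: equilibrium_def x_rhs_def lambda_rhs_def z_rhs_def)
  then show ?thesis by (rule that)
qed

lemma grad_gap_nonneg: "0 \<le> (grad (f i) u - grad (f i) v) \<bullet> (u - v)"
  using grad_strict_mono[OF objective, of u v i] by (cases "u = v") auto

lemma saddle_map_monotone: "0 \<le> (saddle_map E d f p - saddle_map E d f q) \<bullet> (p - q)"
  by (cases p, cases q)
     (auto simp only: saddle_map_gap[OF sym_graph] intro!: add_nonneg_nonneg sum_nonneg
       grad_gap_nonneg laplacian_nonneg[OF sym_graph])

lemma saddle_map_differentiable: "saddle_map E d f differentiable (at p)"
proof -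
  have L: "(laplacian E :: (real ^ 'm) ^ 'n \<Rightarrow> _) differentiable (at v)" for v
    by (rule linear_imp_differentiable[OF linear_laplacian])
  have grad: "grad (f i) differentiable (at v)" for i v
    using objective by (simp add: regular_objective_def)
  have nth: "(\<lambda>v :: (real ^ 'm) ^ 'n. v $ i) differentiable (at v)" for i v
    by (rule bounded_linear_imp_differentiable) (rule bounded_linear_vec_nth)
  have fst: "fst differentiable (at q)" for q :: "((real ^ 'm) ^ 'n) \<times> 'c::real_normed_vector"
    by (rule bounded_linear_imp_differentiable) (rule bounded_linear_fst)
  have snd: "snd differentiable (at q)" for q :: "((real ^ 'm) ^ 'n) \<times> 'c::real_normed_vector"
    by (rule bounded_linear_imp_differentiable) (rule bounded_linear_snd)
  have x: "(\<lambda>p. fst p $ i) differentiable (at p)"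
    and lam: "(\<lambda>p. fst (snd p)) differentiable (at p)"
    and z: "(\<lambda>p. snd (snd p)) differentiable (at p)"
    for i and p :: "('m, 'n) state"
    by (auto intro: differentiable_compose[OF nth] differentiable_compose[OF fst]
        differentiable_compose[OF snd] fst snd)
  have "saddle_map E d f = (\<lambda>p.
     ((\<chi> i. grad (f i) (fst p $ i) - fst (snd p) $ i),
      laplacian E (fst (snd p)) + laplacian E (snd (snd p)) - (\<chi> i. d i) + fst p,
      - laplacian E (fst (snd p))))"
    by (auto simp: saddle_map_def fun_eq_iff)
  then show ?thesis
    by (simp only:)
       (intro differentiable_Pair differentiable_vec_lambda differentiable_add differentiable_diff
         differentiable_minus differentiable_const differentiable_compose[OF grad]
         differentiable_compose[OF L] differentiable_compose[OF nth] x lam z fst)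
qed

text \<open>
  The monotonicity gap relative to an equilibrium with first component \<open>X\<close> tends to zero, which by
  strict monotonicity forces \<open>x\<close> towards \<open>X\<close> and the Laplacian of \<open>lam\<close> towards zero. Barbalat's lemma
  then applies to these two convergent quantities: the velocity of \<open>x\<close> and the Laplacian of the
  velocity of \<open>lam\<close> also tend to zero. In the limit \<open>x = X\<close> balances the resources, so the velocity of
  \<open>lam\<close> has zero sum over the agents; having zero Laplacian as well, it vanishes. So the
  whole velocity tends to zero.
\<close>

lemma trajectory_converges:
  assumes X: "optimal_allocation \<Omega> d f X"
    and traj: "trajectory E \<Omega> d f x lam z" and init: "\<And>i. x 0 $ i \<in> \<Omega> i"
  shows "bounded ((\<lambda>t. (x t, lam t, z t)) ` {0..})"
    and "\<exists>lam_star z_star. equilibrium E \<Omega> d f X lam_star z_star \<and>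
      ((\<lambda>t. (x t, lam t, z t)) \<longlongrightarrow> (X, lam_star, z_star)) at_top"
proof -
  let ?F = "saddle_map E d f" and ?L = "laplacian E :: (real ^ 'm) ^ 'n \<Rightarrow> (real ^ 'm) ^ 'n"
  define s where "s t = (x t, lam t, z t)" for t
  interpret monotone_projected_flow "state_constraint \<Omega>" ?F s
  proof
    show "closed (state_constraint \<Omega>)" "convex (state_constraint \<Omega>)"
      unfolding state_constraint_def
      by (intro closed_Times convex_Times closed_vec_product convex_vec_product closed_\<Omega> convex_\<Omega>
          closed_UNIV convex_UNIV)+
    show "s 0 \<in> state_constraint \<Omega>"
      using init by (simp add: s_def state_constraint_def)
    fix t :: real assume "0 \<le> t"
    have "((\<lambda>t. (\<chi> i. x t $ i, \<chi> i. lam t $ i, \<chi> i. z t $ i)) has_vector_derivative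
        projected_field E \<Omega> d f (s t)) (at t within {0..})"
      unfolding s_def projected_field_eq[OF convex_\<Omega> closed_\<Omega> nonempty_\<Omega>]
      using traj \<open>0 \<le> t\<close> unfolding trajectory_def
      by (intro has_vector_derivative_Pair has_vector_derivative_vec_lambda) auto
    then have "(s has_vector_derivative projected_field E \<Omega> d f (s t)) (at t within {0..})"
      by (simp add: s_def[abs_def])
    then show "(s has_vector_derivative
        closest_point (state_constraint \<Omega>) (s t - ?F (s t)) - s t) (at t within {0..})"
      by (simp add: projected_field_def)
  qed (rule saddle_map_differentiable saddle_map_monotone)+
  have velocity_eq: "velocity = projected_field E \<Omega> d f"
    by (simp add: fun_eq_iff velocity_def projected_field_def)
  have contL: "continuous_on S ?L" for S
    by (rule linear_continuous_on) (simp add: linear_laplacian linear_conv_bounded_linear[symmetric])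
  have cont [continuous_intros]: "continuous_on UNIV (\<lambda>p. ?L (g p))" if "continuous_on UNIV g"
    for g :: "('m, 'n) state \<Rightarrow> _"
    using that by (rule continuous_on_compose2[OF contL[of UNIV]]) simp
  obtain lam0 z0 where eq0: "equilibrium E \<Omega> d f X lam0 z0"
    using optimal_imp_equilibrium[OF X] .
  define q where "q = (X, lam0, z0)"
  have q: "velocity q = 0"
    using eq0 by (simp add: velocity_eq q_def equilibrium_iff_projected_field)
  have L0: "?L lam0 = 0"
    using eq0 by (simp add: equilibrium_def z_rhs_def laplacian_def vec_eq_iff)
  note bdd = bounded_trajectory[OF q]
  then show "bounded ((\<lambda>t. (x t, lam t, z t)) ` {0..})" by (simp add: s_def)

  \<comment> \<open>\<open>u\<close> vanishes exactly where the gap does, and \<open>u'\<close> is its derivative along the dynamics.\<close>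
  define u where "u p = (fst p - X, ?L (fst (snd p)))" for p :: "('m, 'n) state"
  define u' where "u' p = (fst (velocity p), ?L (fst (snd (velocity p))))" for p
  have u_cont: "continuous_on UNIV u" and u'_cont: "continuous_on UNIV u'"
    unfolding u_def u'_def by (intro continuous_intros continuous_velocity)+
  have u_lim: "((\<lambda>t. u (s t)) \<longlongrightarrow> 0) at_top"
  proof (rule tendsto_zero_if_zeros_subset[OF bdd _ u_cont monotonicity_gap_tendsto_zero[OF q]])
    show "continuous_on UNIV (\<lambda>p. (?F p - ?F q) \<bullet> (p - q))"
      by (intro continuous_intros continuous_F)
    fix p assume gap: "(?F p - ?F q) \<bullet> (p - q) = 0"
    obtain x lam z where p: "p = (x, lam, z)" by (cases p)
    have sum0: "(\<Sum>i\<in>UNIV. (grad (f i) (x $ i) - grad (f i) (X $ i)) \<bullet> (x $ i - X $ i)) = 0"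
      and lap0: "(lam - lam0) \<bullet> ?L (lam - lam0) = 0"
      using gap laplacian_nonneg[OF sym_graph, of "lam - lam0"]
        sum_nonneg[of UNIV "\<lambda>i. (grad (f i) (x $ i) - grad (f i) (X $ i)) \<bullet> (x $ i - X $ i)"]
        grad_gap_nonneg
      unfolding p q_def saddle_map_gap[OF sym_graph] by (simp_all add: add_nonneg_eq_0_iff)
    have "x $ i = X $ i" for i
    proof (rule ccontr)
      assume "x $ i \<noteq> X $ i"
      then have "0 < (grad (f i) (x $ i) - grad (f i) (X $ i)) \<bullet> (x $ i - X $ i)"
        by (rule grad_strict_mono[OF objective])
      moreover have "(grad (f i) (x $ i) - grad (f i) (X $ i)) \<bullet> (x $ i - X $ i) = 0"
        using sum0 by (subst (asm) sum_nonneg_eq_0_iff) (auto simp: grad_gap_nonneg)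
      ultimately show False by simp
    qed
    then have "x = X" by (simp add: vec_eq_iff)
    have "lam - lam0 = (\<chi> i. (lam - lam0) $ undefined)"
      using laplacian_kernel[OF graph lap0] by (simp add: vec_eq_iff)
    then have "?L (lam - lam0) = 0" by (metis laplacian_const)
    then have "?L lam = 0" using L0 by (simp add: linear_diff[OF linear_laplacian])
    with \<open>x = X\<close> show "u p = 0" by (simp add: u_def p zero_prod_def)
  qed
  have u_deriv: "((\<lambda>t. u (s t)) has_vector_derivative u' (s t)) (at t within {0..})" if "0 \<le> t" for t
  proof -
    have bl: "bounded_linear (\<lambda>p :: ('m, 'n) state. (fst p, ?L (fst (snd p))))"
      unfolding linear_conv_bounded_linear[symmetric]
      by (rule linearI) (simp_all add: linear_add[OF linear_laplacian] linear_cmul[OF linear_laplacian])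
    have "((\<lambda>t. (fst (s t), ?L (fst (snd (s t)))) - (X, 0)) has_vector_derivative u' (s t) - 0) (at t within {0..})"
      unfolding u'_def
      by (intro has_vector_derivative_diff has_vector_derivative_const
          bounded_linear.has_vector_derivative[OF bl flow_velocity[OF that]])
    then show ?thesis by (simp add: u_def)
  qed
  have u'_lim: "((\<lambda>t. u' (s t)) \<longlongrightarrow> 0) at_top"
    using u_deriv u_lim uniformly_continuous_along_trajectory[OF bdd u'_cont]
    by (rule derivative_tendsto_zero)
  have "((\<lambda>t. velocity (s t)) \<longlongrightarrow> 0) at_top"
  proof (rule tendsto_zero_if_zeros_subset[OF bdd _ continuous_velocity])
    show "continuous_on UNIV (\<lambda>p. (u p, u' p))"
      by (rule continuous_on_Pair[OF u_cont u'_cont])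
    show "((\<lambda>t. (u (s t), u' (s t))) \<longlongrightarrow> 0) at_top"
      using tendsto_Pair[OF u_lim u'_lim] by (simp add: zero_prod_def)
    fix p assume "(u p, u' p) = 0"
    then have "u p = 0" "u' p = 0" by (simp_all add: zero_prod_def)
    obtain x lam z where p: "p = (x, lam, z)" by (cases p)
    define w where "w = (\<chi> i. lambda_rhs E d x lam z i)"
    from \<open>u p = 0\<close> have "x = X" "?L lam = 0"
      by (simp_all add: u_def p zero_prod_def)
    from \<open>u' p = 0\<close> have x_rest: "(\<chi> i. x_rhs \<Omega> f x lam i) = 0" and "?L w = 0"
      by (simp_all add: u'_def p w_def zero_prod_def velocity_eq
          projected_field_eq[OF convex_\<Omega> closed_\<Omega> nonempty_\<Omega>])
    have w: "w = - ?L lam - ?L z + ((\<chi> i. d i) - x)"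
      by (simp add: w_def vec_eq_iff lambda_rhs_def laplacian_def)
    have "(\<Sum>i\<in>UNIV. w $ i) = (\<Sum>i\<in>UNIV. d i) - (\<Sum>i\<in>UNIV. X $ i)"
      using \<open>x = X\<close> by (simp add: w sum.distrib sum_subtractf sum_negf sum_laplacian[OF sym_graph])
    also have "\<dots> = 0"
      using X by (simp add: optimal_allocation_def is_arg_min_def feasible_def)
    finally have "w = 0"
      by (rule laplacian_eq_zero_imp_zero[OF graph \<open>?L w = 0\<close>])
    moreover have "(\<chi> i. z_rhs E lam i) = 0"
      using \<open>?L lam = 0\<close> by (simp add: z_rhs_def laplacian_def)
    ultimately show "velocity p = 0"
      using x_rest unfolding w_def
      by (simp add: p velocity_eq projected_field_eq[OF convex_\<Omega> closed_\<Omega> nonempty_\<Omega>] zero_prod_def)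
  qed
  then obtain p where "velocity p = 0" and lim: "(s \<longlongrightarrow> p) at_top"
    using converges_if_velocity_vanishes[OF q] by blast
  obtain x1 lam1 z1 where p: "p = (x1, lam1, z1)" by (cases p)
  have "((\<lambda>t. fst (s t) - X) \<longlongrightarrow> x1 - X) at_top"
    using tendsto_fst[OF lim] by (intro tendsto_intros) (simp add: p)
  moreover have "((\<lambda>t. fst (s t) - X) \<longlongrightarrow> 0) at_top"
    using tendsto_fst[OF u_lim] by (simp add: u_def)
  \<comment> \<open>The limit has the prescribed component \<open>X\<close>, because \<open>u\<close> vanishes along the trajectory.\<close>
  ultimately have "x1 = X"
    using tendsto_unique[OF trivial_limit_at_top_linorder] by fastforce
  with \<open>velocity p = 0\<close> lim show "\<exists>lam_star z_star. equilibrium E \<Omega> d f X lam_star z_star \<and>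
      ((\<lambda>t. (x t, lam t, z t)) \<longlongrightarrow> (X, lam_star, z_star)) at_top"
    by (auto simp: p velocity_eq equilibrium_iff_projected_field s_def[abs_def])
qed

end

section \<open>Convergence to the optimal allocation\<close>

theorem theorem3p4:
  fixes E :: "('n::finite \<times> 'n) set"
    and \<Omega> :: "'n \<Rightarrow> (real ^ 'm) set"
    and d :: "'n \<Rightarrow> real ^ 'm"
    and f :: "'n \<Rightarrow> real ^ 'm \<Rightarrow> real"
    and x lam z :: "real \<Rightarrow> (real ^ 'm) ^ 'n"
  assumes "\<And>i. closed (\<Omega> i)" and "\<And>i. convex (\<Omega> i)"
    and "\<And>i. regular_objective (f i)"
    and "\<exists>X. optimal_allocation \<Omega> d f X" and "slater_condition \<Omega> d"
    and "undirected_connected E"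
    and "trajectory E \<Omega> d f x lam z"
    and "\<And>i. x 0 $ i \<in> \<Omega> i"
  shows "bounded (x ` {0..}) \<and> bounded (lam ` {0..}) \<and> bounded (z ` {0..}) \<and>
    (\<exists>x_star lam_star z_star.
       equilibrium E \<Omega> d f x_star lam_star z_star \<and>
       (x \<longlongrightarrow> x_star) at_top \<and> (lam \<longlongrightarrow> lam_star) at_top \<and> (z \<longlongrightarrow> z_star) at_top \<and>
       (\<forall>i. ((\<lambda>t. x t $ i) \<longlongrightarrow> x_star $ i) at_top) \<and>
       optimal_allocation \<Omega> d f x_star \<and>
       (\<forall>y. optimal_allocation \<Omega> d f y \<longrightarrow> y = x_star))"
proof -
  interpret resource_allocation E \<Omega> d f
    by unfold_locales (rule assms)+
  obtain X where X: "optimal_allocation \<Omega> d f X" using assms(4) by blast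
  note conv = trajectory_converges[OF _ assms(7,8)]
  have bdd: "bounded (x ` {0..})" "bounded (lam ` {0..})" "bounded (z ` {0..})"
    using bounded_fst[OF conv(1)[OF X]] bounded_fst[OF bounded_snd[OF conv(1)[OF X]]]
      bounded_snd[OF bounded_snd[OF conv(1)[OF X]]]
    by (simp_all add: image_image)
  \<comment> \<open>The same trajectory tends to every optimal allocation, so there is only one.\<close>
  have x_lim: "(x \<longlongrightarrow> y) at_top" if "optimal_allocation \<Omega> d f y" for y
    using conv(2)[OF that] by (auto dest: tendsto_fst)
  obtain lam_star z_star where eq: "equilibrium E \<Omega> d f X lam_star z_star"
    and lim: "((\<lambda>t. (x t, lam t, z t)) \<longlongrightarrow> (X, lam_star, z_star)) at_top"
    using conv(2)[OF X] by blast
  have "(lam \<longlongrightarrow> lam_star) at_top" "(z \<longlongrightarrow> z_star) at_top"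
    using tendsto_fst[OF tendsto_snd[OF lim]] tendsto_snd[OF tendsto_snd[OF lim]] by simp_all
  moreover have "y = X" if "optimal_allocation \<Omega> d f y" for y
    using tendsto_unique[OF trivial_limit_at_top_linorder x_lim[OF that] x_lim[OF X]] .
  moreover have "((\<lambda>t. x t $ i) \<longlongrightarrow> X $ i) at_top" for i
    using x_lim[OF X] by (rule tendsto_vec_nth)
  ultimately show ?thesis
    using bdd eq X x_lim[OF X] by blast
qed

end
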